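(* Let $(X_n)_{n\ge0}$ be Markov chains on $(\mathbb S_n)_{n\ge0}$ with rates $(c_n)$ and down-operators $(D_n)$ satisfying (A0)--(A5) of the context, let $E,\iota,(d^o_s)_{s\in\mathbb S}$ satisfy (L1)--(L3) of the context, and suppose $c_n\to\infty$. Let $F$ be the limiting Feller process in $E$, and let $M$ be the finite measure on $E$ with $\int_Ef\,dM=[h^o_\varnothing]f$ for all $f\in C(E)$ (see context). Then each of the following statements holds and characterizes the finite measure $M$: (i) $\int_Ed^o_s\,dM=M_{|s|}(s)$ for all $s\in\mathbb S$; (ii) $F(t)$ converges to $M$ in distribution as $t\to\infty$ for any initial condition; (iii) $M$ is a stationary distribution of $F$; (iv) $M_n\circ\iota|_{\mathbb S_n}^{-1}\to M$ weakly as $n\to\infty$; (v) $Mk_n=M_n$ for all $n\ge0$, where $(Mk_n)(s)=\int_Ek_n(x,s)\,dM(x)$ and $k_n(x,s)=d^o_s(x)$ for $x\in E$, $s\in\mathbb S_n$.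
   Context: $C(Z)$: continuous real functions on $Z$ with the sup norm (all functions if $Z$ finite). A transition operator from $C(Z')$ to $C(Z)$ ($Z,Z'$ finite) is a map $f\mapsto\sum_{y\in Z'}\mu(\cdot,y)f(y)$ with $\mu$ a stochastic $Z\times Z'$ matrix. $\mathbb S=\bigcup_n\mathbb S_n$; $|s|$ is the $n$ with $s\in\mathbb S_n$; $\mathbf 1_u$ is the indicator of $\{u\}$; $c_{-1}=0$; $(f)_n=f|_{\mathbb S_n}$. (A0) $\mathbb S_0,\mathbb S_1,\dots$ are finite and pairwise disjoint and $\mathbb S_0=\{\varnothing\}$. $T_n$ is the transition operator of the Markov chain $X_n$ on $\mathbb S_n$, $A_n=c_n(T_n-I)$, $(D_n)_{n\ge1}$ are linear operators, and for all $n\ge0$: (A1) $0<c_n<c_{n+1}$; (A2) $D_{n+1}$ is a transition operator from $C(\mathbb S_n)$ to $C(\mathbb S_{n+1})$; (A3) $\operatorname{range}(A_{n+1}+c_nI)\subset\operatorname{range}D_{n+1}$; (A4) $D_{n+1}$ is injective; (A5) $A_{n+1}D_{n+1}=D_{n+1}A_n$. $U_n:C(\mathbb S_{n+1})\to C(\mathbb S_n)$ is the unique linear operator with $c_nD_{n+1}U_n=A_{n+1}+c_nI$; $M_n(s)=(U_0U_1\cdots U_{n-1}\mathbf 1_s)(\varnothing)$ for $s\in\mathbb S_n$ (this is a probability measure, the unique stationary distribution of $X_n$). $d_s(u)=(D_{|u|}\cdots D_{|s|+1}\mathbf 1_s)(u)$ if $|u|\ge|s|$ ($=\mathbf 1_s(u)$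 if $|u|=|s|$), else $0$. $E$ is a compact metric space, $\iota:\mathbb S\to E$ a map, $d^o_s\in C(E)$, and: (L1) for every $x\in E$ there are $s_n\in\mathbb S_n$ with $\iota(s_n)\to x$; (L2) $\operatorname{span}\{d^o_s\}$ is dense in $C(E)$; (L3) $\|(d_s)_n-d^o_s\circ\iota|_{\mathbb S_n}\|_{C(\mathbb S_n)}\to0$ for each $s$. $F$ is the Feller process in $E$ whose transition semigroup $(\mathcal T(t))$ is the unique Feller semigroup on $C(E)$ with $\|T_n^{\lfloor c_nt\rfloor}(f\circ\iota|_{\mathbb S_n})-(\mathcal T(t)f)\circ\iota|_{\mathbb S_n}\|_{C(\mathbb S_n)}\to0$ for all $f\in C(E)$, $t\ge0$ (known to exist when $c_n\to\infty$). With $\eta_{i,j}=\prod_{m=i}^{j-1}\frac{c_m}{c_{m-1}-c_{j-1}}$ and $h^o_s=\sum_{|r|\le|s|}(U_{|r|}\cdots U_{|s|-1}\mathbf 1_s)(r)\,\eta_{|r|,|s|}\,d^o_r$, it satisfies $\mathcal T(t)h^o_s=e^{-tc_{|s|-1}}h^o_s$. $[h^o_\varnothing]$ is the unique bounded linear functional on $C(E)$ with $[h^o_\varnothing]d^o_s=M_{|s|}(s)$ for all $s\in\mathbb S$; it is known to exist, to be positive and contractive, and to satisfy $[h^o_\varnothing]f=\lim_{t\to\infty}\int\mathcal T(t)f\,d\nu$ for every probability measure $\nu$ on $E$ and $[h^o_\varnothing]f=\lim_n\int f\circ\iota|_{\mathbb S_n}\,dM_n$, for $f\in C(E)$. "Characterizes"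 means that $M$ is the only finite measure on $E$ for which the statement holds. *)

theory Defs
  imports "HOL-Probability.Probability"
begin

section \<open>Operators on finite state spaces\<close>

text \<open>For a finite set \<open>Z\<close>, the space \<open>C(Z)\<close> is represented by the functions on the ambient
  type that vanish off \<open>Z\<close>; thus equality in \<open>C(Z)\<close> is equality of functions, and the
  indicator of a point of \<open>Z\<close> is an element of \<open>C(Z)\<close>.\<close>

definition fun_on :: "'s set \<Rightarrow> ('s \<Rightarrow> real) set" where
  "fun_on Z = {f. \<forall>x. x \<notin> Z \<longrightarrow> f x = 0}"

definition sup_norm_on :: "'s set \<Rightarrow> ('s \<Rightarrow> real) \<Rightarrow> real" where
  "sup_norm_on Z f = (SUP x\<in>Z. \<bar>f x\<bar>)"

definition stochastic_matrix :: "'s set \<Rightarrow> 's set \<Rightarrow> ('s \<Rightarrow> 's \<Rightarrow> real) \<Rightarrow> bool" where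
  "stochastic_matrix Z Z' \<mu> \<longleftrightarrow>
     (\<forall>x\<in>Z. (\<forall>y\<in>Z'. 0 \<le> \<mu> x y) \<and> (\<Sum>y\<in>Z'. \<mu> x y) = 1)"

text \<open>A transition operator from \<open>C(Z')\<close> to \<open>C(Z)\<close>; its values off \<open>C(Z')\<close> are irrelevant.\<close>

definition transition_operator ::
    "'s set \<Rightarrow> 's set \<Rightarrow> (('s \<Rightarrow> real) \<Rightarrow> 's \<Rightarrow> real) \<Rightarrow> bool" where
  "transition_operator Z' Z L \<longleftrightarrow>
     (\<exists>\<mu>. stochastic_matrix Z Z' \<mu> \<and>
        (\<forall>f\<in>fun_on Z'. L f = (\<lambda>x. if x \<in> Z then \<Sum>y\<in>Z'. \<mu> x y * f y else 0)))"


section \<open>Chains, down-operators and up-operators\<close>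

definition gen_op ::
    "(nat \<Rightarrow> real) \<Rightarrow> (nat \<Rightarrow> ('s \<Rightarrow> real) \<Rightarrow> 's \<Rightarrow> real) \<Rightarrow> nat \<Rightarrow> ('s \<Rightarrow> real) \<Rightarrow> 's \<Rightarrow> real" where
  "gen_op c T n f = (\<lambda>x. c n * (T n f x - f x))"

definition level :: "(nat \<Rightarrow> 's set) \<Rightarrow> 's \<Rightarrow> nat" where
  "level S s = (THE n. s \<in> S n)"

text \<open>The operator \<open>U\<^sub>n\<close>, defined by its value at each \<open>f \<in> C(S\<^sub>n\<^sub>+\<^sub>1)\<close>. The lemmas
  \<open>up_op_solves\<close>, \<open>up_op_linear\<close> and \<open>up_op_unique\<close> below show that it is the unique
  (linear) operator with \<open>c\<^sub>n D\<^sub>n\<^sub>+\<^sub>1 U\<^sub>n = A\<^sub>n\<^sub>+\<^sub>1 + c\<^sub>n I\<close>.\<close>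

definition up_op ::
    "(nat \<Rightarrow> 's set) \<Rightarrow> (nat \<Rightarrow> real) \<Rightarrow> (nat \<Rightarrow> ('s \<Rightarrow> real) \<Rightarrow> 's \<Rightarrow> real) \<Rightarrow>
     (nat \<Rightarrow> ('s \<Rightarrow> real) \<Rightarrow> 's \<Rightarrow> real) \<Rightarrow> nat \<Rightarrow> ('s \<Rightarrow> real) \<Rightarrow> 's \<Rightarrow> real" where
  "up_op S c T D n f =
     (THE g. g \<in> fun_on (S n) \<and>
        (\<lambda>x. c n * D (Suc n) g x) = (\<lambda>x. gen_op c T (Suc n) f x + c n * f x))"

text \<open>\<open>up_comp S c T D n\<close> is \<open>U\<^sub>0 U\<^sub>1 \<cdots> U\<^sub>n\<^sub>-\<^sub>1\<close>, and
  \<open>down_comp D m k\<close> is \<open>D\<^sub>m\<^sub>+\<^sub>k \<cdots> D\<^sub>m\<^sub>+\<^sub>1\<close>.\<close>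

primrec up_comp ::
    "(nat \<Rightarrow> 's set) \<Rightarrow> (nat \<Rightarrow> real) \<Rightarrow> (nat \<Rightarrow> ('s \<Rightarrow> real) \<Rightarrow> 's \<Rightarrow> real) \<Rightarrow>
     (nat \<Rightarrow> ('s \<Rightarrow> real) \<Rightarrow> 's \<Rightarrow> real) \<Rightarrow> nat \<Rightarrow> ('s \<Rightarrow> real) \<Rightarrow> 's \<Rightarrow> real" where
  "up_comp S c T D 0 f = f"
| "up_comp S c T D (Suc n) f = up_comp S c T D n (up_op S c T D n f)"

primrec down_comp ::
    "(nat \<Rightarrow> ('s \<Rightarrow> real) \<Rightarrow> 's \<Rightarrow> real) \<Rightarrow> nat \<Rightarrow> nat \<Rightarrow> ('s \<Rightarrow> real) \<Rightarrow> 's \<Rightarrow> real" where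
  "down_comp D m 0 f = f"
| "down_comp D m (Suc k) f = D (m + Suc k) (down_comp D m k f)"

text \<open>The point masses \<open>M\<^sub>n(s)\<close>, where \<open>s0\<close> is the element of \<open>S\<^sub>0\<close>.\<close>

definition stat_mass ::
    "(nat \<Rightarrow> 's set) \<Rightarrow> 's \<Rightarrow> (nat \<Rightarrow> real) \<Rightarrow> (nat \<Rightarrow> ('s \<Rightarrow> real) \<Rightarrow> 's \<Rightarrow> real) \<Rightarrow>
     (nat \<Rightarrow> ('s \<Rightarrow> real) \<Rightarrow> 's \<Rightarrow> real) \<Rightarrow> nat \<Rightarrow> 's \<Rightarrow> real" where
  "stat_mass S s0 c T D n s = up_comp S c T D n (indicator {s}) s0"

definition stat_measure ::
    "(nat \<Rightarrow> 's set) \<Rightarrow> 's \<Rightarrow> (nat \<Rightarrow> real) \<Rightarrow> (nat \<Rightarrow> ('s \<Rightarrow> real) \<Rightarrow> 's \<Rightarrow> real) \<Rightarrow>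
     (nat \<Rightarrow> ('s \<Rightarrow> real) \<Rightarrow> 's \<Rightarrow> real) \<Rightarrow> nat \<Rightarrow> 's measure" where
  "stat_measure S s0 c T D n =
     point_measure (S n) (\<lambda>s. ennreal (stat_mass S s0 c T D n s))"

definition density_fun ::
    "(nat \<Rightarrow> 's set) \<Rightarrow> (nat \<Rightarrow> ('s \<Rightarrow> real) \<Rightarrow> 's \<Rightarrow> real) \<Rightarrow> 's \<Rightarrow> 's \<Rightarrow> real" where
  "density_fun S D s u =
     (if level S s \<le> level S u
      then down_comp D (level S s) (level S u - level S s) (indicator {s}) u else 0)"

lemma transition_operator_linear:
  assumes "transition_operator Z' Z L" "f \<in> fun_on Z'" "g \<in> fun_on Z'"
  shows "L (\<lambda>x. a * f x + b * g x) = (\<lambda>x. a * L f x + b * L g x)"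
proof -
  obtain \<mu> where \<mu>: "\<And>f. f \<in> fun_on Z' \<Longrightarrow>
      L f = (\<lambda>x. if x \<in> Z then \<Sum>y\<in>Z'. \<mu> x y * f y else 0)"
    using assms(1) unfolding transition_operator_def by blast
  have "(\<lambda>x. a * f x + b * g x) \<in> fun_on Z'"
    using assms by (simp add: fun_on_def)
  then show ?thesis
    using assms \<mu> by (auto simp: fun_eq_iff algebra_simps sum.distrib sum_distrib_left)
qed

context
  fixes S :: "nat \<Rightarrow> 's set" and c :: "nat \<Rightarrow> real" and T D n
  assumes T: "transition_operator (S (Suc n)) (S (Suc n)) (T (Suc n))"
    and c_pos: "0 < c n"
    and D: "transition_operator (S n) (S (Suc n)) (D (Suc n))"
    and range: "(\<lambda>f x. gen_op c T (Suc n) f x + c n * f x) ` fun_on (S (Suc n))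
                  \<subseteq> D (Suc n) ` fun_on (S n)"
    and inj: "inj_on (D (Suc n)) (fun_on (S n))"
begin

lemma up_op_ex1:
  assumes "f \<in> fun_on (S (Suc n))"
  shows "\<exists>!g. g \<in> fun_on (S n) \<and>
    (\<lambda>x. c n * D (Suc n) g x) = (\<lambda>x. gen_op c T (Suc n) f x + c n * f x)"
proof (rule ex_ex1I)
  obtain h where h: "h \<in> fun_on (S n)"
      "(\<lambda>x. gen_op c T (Suc n) f x + c n * f x) = D (Suc n) h"
    using range assms by (auto simp: image_subset_iff image_iff)
  define g where "g = (\<lambda>x. (1 / c n) * h x + 0 * h x)"
  have "D (Suc n) g = (\<lambda>x. (1 / c n) * D (Suc n) h x + 0 * D (Suc n) h x)"
    unfolding g_def by (rule transition_operator_linear[OF D h(1) h(1)])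
  moreover have "g \<in> fun_on (S n)"
    using h(1) by (simp add: g_def fun_on_def)
  ultimately show "\<exists>g. g \<in> fun_on (S n) \<and>
      (\<lambda>x. c n * D (Suc n) g x) = (\<lambda>x. gen_op c T (Suc n) f x + c n * f x)"
    using h(2) c_pos by (intro exI[of _ g]) simp
next
  fix g g'
  assume "g \<in> fun_on (S n) \<and>
      (\<lambda>x. c n * D (Suc n) g x) = (\<lambda>x. gen_op c T (Suc n) f x + c n * f x)"
    and "g' \<in> fun_on (S n) \<and>
      (\<lambda>x. c n * D (Suc n) g' x) = (\<lambda>x. gen_op c T (Suc n) f x + c n * f x)"
  then have *: "g \<in> fun_on (S n)" "g' \<in> fun_on (S n)"
      "(\<lambda>x. c n * D (Suc n) g x) = (\<lambda>x. c n * D (Suc n) g' x)"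
    by simp_all
  have "D (Suc n) g = D (Suc n) g'"
    using fun_cong[OF *(3)] c_pos by (simp add: fun_eq_iff)
  then show "g = g'"
    using inj * by (simp add: inj_on_def)
qed

lemma up_op_solves:
  assumes "f \<in> fun_on (S (Suc n))"
  shows "up_op S c T D n f \<in> fun_on (S n)"
    and "c n * D (Suc n) (up_op S c T D n f) x = gen_op c T (Suc n) f x + c n * f x"
  using theI'[OF up_op_ex1[OF assms]] unfolding up_op_def[symmetric]
  by (simp_all add: fun_eq_iff)

lemma up_op_unique:
  assumes "f \<in> fun_on (S (Suc n))" "g \<in> fun_on (S n)"
    and "\<And>x. c n * D (Suc n) g x = gen_op c T (Suc n) f x + c n * f x"
  shows "up_op S c T D n f = g"
  unfolding up_op_def using assms by (intro the1_equality[OF up_op_ex1]) auto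

lemma up_op_linear:
  assumes f: "f \<in> fun_on (S (Suc n))" and g: "g \<in> fun_on (S (Suc n))"
  shows "up_op S c T D n (\<lambda>x. a * f x + b * g x) =
    (\<lambda>x. a * up_op S c T D n f x + b * up_op S c T D n g x)"
proof (rule up_op_unique)
  show "(\<lambda>x. a * f x + b * g x) \<in> fun_on (S (Suc n))"
    using assms by (simp add: fun_on_def)
  note U = up_op_solves[OF f] up_op_solves[OF g]
  show "(\<lambda>x. a * up_op S c T D n f x + b * up_op S c T D n g x) \<in> fun_on (S n)"
    using U(1,3) by (simp add: fun_on_def)
  show "c n * D (Suc n) (\<lambda>x. a * up_op S c T D n f x + b * up_op S c T D n g x) x
      = gen_op c T (Suc n) (\<lambda>x. a * f x + b * g x) x + c n * (a * f x + b * g x)" for x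
  proof -
    have "c n * D (Suc n) (\<lambda>x. a * up_op S c T D n f x + b * up_op S c T D n g x) x
      = a * (c n * D (Suc n) (up_op S c T D n f) x) + b * (c n * D (Suc n) (up_op S c T D n g) x)"
      by (simp add: transition_operator_linear[OF D U(1,3)] algebra_simps)
    also have "\<dots> = gen_op c T (Suc n) (\<lambda>x. a * f x + b * g x) x + c n * (a * f x + b * g x)"
      unfolding U(2,4) gen_op_def transition_operator_linear[OF T f g]
      by (simp add: algebra_simps)
    finally show ?thesis .
  qed
qed

end


section \<open>Feller semigroups and processes on a compact metric space\<close>

text \<open>On a compact space the type of bounded continuous real functions, with the sup norm,
  is \<open>C(E)\<close>.\<close>

definition restrict_to :: "('s \<Rightarrow> 'e) \<Rightarrow> 's set \<Rightarrow> ('e::topological_space \<Rightarrow>\<^sub>C real) \<Rightarrow> 's \<Rightarrow> real" where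
  "restrict_to \<iota> Z f = (\<lambda>s. if s \<in> Z then f (\<iota> s) else 0)"

text \<open>Only times \<open>t \<ge> 0\<close> matter. Conservativity is not part of the definition: for the
  semigroups obtained as limits of Markov chains it is automatic.\<close>

definition feller_semigroup ::
    "(real \<Rightarrow> ('e::metric_space \<Rightarrow>\<^sub>C real) \<Rightarrow> ('e \<Rightarrow>\<^sub>C real)) \<Rightarrow> bool" where
  "feller_semigroup Q \<longleftrightarrow>
     (\<forall>t\<ge>0. bounded_linear (Q t) \<and> (\<forall>f. norm (Q t f) \<le> norm f) \<and>
        (\<forall>f. (\<forall>x. 0 \<le> apply_bcontfun f x) \<longrightarrow>
             (\<forall>x. 0 \<le> apply_bcontfun (Q t f) x))) \<and>
     (\<forall>f. Q 0 f = f) \<and>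
     (\<forall>s\<ge>0. \<forall>t\<ge>0. \<forall>f. Q (s + t) f = Q s (Q t f)) \<and>
     (\<forall>f. ((\<lambda>t. Q t f) \<longlongrightarrow> f) (at_right 0))"

definition past :: "'w measure \<Rightarrow> (real \<Rightarrow> 'w \<Rightarrow> 'e::topological_space) \<Rightarrow> real \<Rightarrow> 'w measure" where
  "past \<Omega> X s = sigma (space \<Omega>)
     {X r -` B \<inter> space \<Omega> | r B. 0 \<le> r \<and> r \<le> s \<and> B \<in> sets borel}"

text \<open>A Markov process with transition semigroup \<open>Q\<close> and initial distribution \<open>\<nu>\<close>.\<close>

definition markov_process ::
    "(real \<Rightarrow> ('e::metric_space \<Rightarrow>\<^sub>C real) \<Rightarrow> ('e \<Rightarrow>\<^sub>C real)) \<Rightarrow> 'e measure \<Rightarrow>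
     'w measure \<Rightarrow> (real \<Rightarrow> 'w \<Rightarrow> 'e) \<Rightarrow> bool" where
  "markov_process Q \<nu> \<Omega> X \<longleftrightarrow>
     prob_space \<Omega> \<and> (\<forall>t\<ge>0. X t \<in> borel_measurable \<Omega>) \<and> distr \<Omega> borel (X 0) = \<nu> \<and>
     (\<forall>s\<ge>0. \<forall>t\<ge>0. \<forall>f.
        AE \<omega> in \<Omega>. real_cond_exp \<Omega> (past \<Omega> X s) (\<lambda>\<omega>. apply_bcontfun f (X (s + t) \<omega>)) \<omega>
          = Q t f (X s \<omega>))"

definition borel_prob :: "'e::topological_space measure \<Rightarrow> bool" where
  "borel_prob \<nu> \<longleftrightarrow> sets \<nu> = sets borel \<and> prob_space \<nu>"

definition finite_borel :: "'e::topological_space measure \<Rightarrow> bool" where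
  "finite_borel \<nu> \<longleftrightarrow> sets \<nu> = sets borel \<and> finite_measure \<nu>"

text \<open>The Feller process with semigroup \<open>Q\<close>, as a family: for each initial distribution \<open>\<nu>\<close>,
  \<open>F \<nu>\<close> is the process started from \<open>\<nu>\<close>, defined on the probability space \<open>\<Omega> \<nu>\<close>. Regularity
  of the sample paths is not required.\<close>

definition feller_process ::
    "(real \<Rightarrow> ('e::metric_space \<Rightarrow>\<^sub>C real) \<Rightarrow> ('e \<Rightarrow>\<^sub>C real)) \<Rightarrow> ('e measure \<Rightarrow> 'w measure) \<Rightarrow>
     ('e measure \<Rightarrow> real \<Rightarrow> 'w \<Rightarrow> 'e) \<Rightarrow> bool" where
  "feller_process Q \<Omega> F \<longleftrightarrow>
     feller_semigroup Q \<and> (\<forall>\<nu>. borel_prob \<nu> \<longrightarrow> markov_process Q \<nu> (\<Omega> \<nu>) (F \<nu>))"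

definition law_at ::
    "('e measure \<Rightarrow> 'w measure) \<Rightarrow> ('e measure \<Rightarrow> real \<Rightarrow> 'w \<Rightarrow> 'e) \<Rightarrow> 'e measure \<Rightarrow> real \<Rightarrow>
     'e::topological_space measure" where
  "law_at \<Omega> F \<nu> t = distr (\<Omega> \<nu>) borel (F \<nu> t)"

definition stationary_distribution ::
    "('e measure \<Rightarrow> 'w measure) \<Rightarrow> ('e measure \<Rightarrow> real \<Rightarrow> 'w \<Rightarrow> 'e) \<Rightarrow>
     'e::topological_space measure \<Rightarrow> bool" where
  "stationary_distribution \<Omega> F N \<longleftrightarrow> borel_prob N \<and> (\<forall>t\<ge>0. law_at \<Omega> F N t = N)"

text \<open>The library's \<open>weak_conv_m\<close> only covers sequences of measures on the real line.\<close>

definition weak_convergence ::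
    "('i \<Rightarrow> 'e::topological_space measure) \<Rightarrow> 'e measure \<Rightarrow> 'i filter \<Rightarrow> bool" where
  "weak_convergence \<mu> N G \<longleftrightarrow>
     (\<forall>f :: 'e \<Rightarrow>\<^sub>C real.
        ((\<lambda>i. \<integral>x. apply_bcontfun f x \<partial>\<mu> i) \<longlongrightarrow> (\<integral>x. apply_bcontfun f x \<partial>N)) G)"

definition link_kernel :: "('s \<Rightarrow> ('e::topological_space \<Rightarrow>\<^sub>C real)) \<Rightarrow> 'e \<Rightarrow> 's \<Rightarrow> real" where
  "link_kernel d\<^sub>o x s = d\<^sub>o s x"

definition measure_kernel :: "'e measure \<Rightarrow> ('e \<Rightarrow> 's \<Rightarrow> real) \<Rightarrow> 's \<Rightarrow> real" where
  "measure_kernel N k s = (\<integral>x. k x s \<partial>N)"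

definition holds_and_characterizes ::
    "('e::topological_space measure \<Rightarrow> bool) \<Rightarrow> 'e measure \<Rightarrow> bool" where
  "holds_and_characterizes P M \<longleftrightarrow> P M \<and> (\<forall>N. finite_borel N \<and> P N \<longrightarrow> N = M)"

end

theory Submission
  imports Defs "HOL-Real_Asymp.Real_Asymp"
begin

text \<open>By (A3) and (A5) every function on level \<open>n\<close> is a constant plus eigenfunctions of the generator
  with eigenvalues \<open>- c j\<close>, \<open>j < n\<close>. The constant is the mass \<open>M n\<close> of the function, since the
  mass annihilates the range of the generator. The down-operators commute with the generators,
  so the lift of an eigenfunction to level \<open>m\<close> is an eigenfunction of \<open>T m\<close>, and in the limit
  \<open>Q t\<close> multiplies the corresponding function on \<open>E\<close> by \<open>exp (- c j * t)\<close>. Hence \<open>Q t f\<close> converges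
  in norm to the constant \<open>h f\<close>, first for \<open>f\<close> in the span of the functions \<open>d\<^sub>o s\<close> and, as the
  \<open>Q t\<close> are contractions, for all \<open>f\<close>; this gives (ii) and the invariance in (iii). Nonnegativity of
  the masses follows from \<open>M n s = \<integral> d\<^sub>o s \<partial>M\<close> and \<open>d\<^sub>o s \<ge> 0\<close>. Each characterization holds because a
  finite Borel measure is determined by its values on a dense set of continuous functions.\<close>


section \<open>Bounded continuous functions as test functions\<close>

lemma finite_borel_integrable_bcontfun:
  fixes f :: "'e::topological_space \<Rightarrow>\<^sub>C real"
  assumes "finite_borel N"
  shows "integrable N f"
proof (rule finite_measure.integrable_const_bound[where B = "norm f"])
  show "finite_measure N" using assms by (simp add: finite_borel_def)
  show "AE x in N. norm (f x) \<le> norm f" using norm_bounded[of f] by simp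
  have "apply_bcontfun f \<in> borel_measurable borel"
    by (intro borel_measurable_continuous_onI) simp
  then show "apply_bcontfun f \<in> borel_measurable N"
    using assms by (simp add: finite_borel_def measurable_cong_sets[of N borel borel borel])
qed

text \<open>The total mass bounds the norm, so density arguments apply to any finite measure that
  competes with \<open>M\<close>.\<close>

lemma bounded_linear_integral_bcontfun:
  fixes N :: "'e::topological_space measure"
  assumes "finite_borel N"
  shows "bounded_linear (\<lambda>f :: 'e \<Rightarrow>\<^sub>C real. \<integral>x. f x \<partial>N)"
proof (rule bounded_linear_intro[where K = "measure N (space N)"])
  note I = finite_borel_integrable_bcontfun[OF assms]
  fix f g :: "'e \<Rightarrow>\<^sub>C real" and r :: real
  show "(\<integral>x. (f + g) x \<partial>N) = (\<integral>x. f x \<partial>N) + (\<integral>x. g x \<partial>N)"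
    using I by simp
  show "(\<integral>x. (r *\<^sub>R f) x \<partial>N) = r *\<^sub>R (\<integral>x. f x \<partial>N)"
    by simp
  have "norm (\<integral>x. f x \<partial>N) \<le> (\<integral>x. norm (f x) \<partial>N)"
    by (rule integral_norm_bound)
  also have "\<dots> \<le> (\<integral>x. norm f \<partial>N)"
    using assms I by (intro integral_mono integrable_norm)
      (auto simp: finite_borel_def norm_bounded finite_measure.integrable_const simp del: real_norm_def)
  finally show "norm (\<integral>x. f x \<partial>N) \<le> norm f * measure N (space N)"
    by (simp add: mult.commute)
qed

text \<open>A closed set \<open>C\<close> is the limit of the test functions \<open>max 0 (1 - n * infdist x C)\<close>, and
  closed sets generate the Borel sets.\<close>

lemma finite_borel_eqI_bcontfun:
  fixes N N' :: "'e::metric_space measure"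
  assumes N: "finite_borel N" and N': "finite_borel N'"
    and eq: "\<And>f :: 'e \<Rightarrow>\<^sub>C real. (\<integral>x. f x \<partial>N) = (\<integral>x. f x \<partial>N')"
  shows "N = N'"
proof (rule measure_eqI_generator_eq[where E = "Collect closed" and \<Omega> = UNIV and A = "\<lambda>_. UNIV"])
  show "Int_stable (Collect (closed :: 'e set \<Rightarrow> bool))"
    by (auto simp: Int_stable_def)
  have "sets (borel :: 'e measure) = sigma_sets UNIV (Collect closed)"
    unfolding borel_eq_closed by simp
  then show "sets N = sigma_sets UNIV (Collect closed)" "sets N' = sigma_sets UNIV (Collect closed)"
    using N N' by (simp_all add: finite_borel_def)
  show "emeasure N UNIV \<noteq> \<infinity>"
    using N by (simp add: finite_borel_def finite_measure.emeasure_finite)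
  fix C :: "'e set"
  assume "C \<in> Collect closed"
  then have C: "closed C" by simp
  show "emeasure N C = emeasure N' C"
  \<comment> \<open>The empty set is split off because \<open>infdist x {}\<close> is 0 by
    convention, which would make every \<open>b n\<close> constantly 1.\<close>
  proof (cases "C = {}")
    case False
    define b where "b n x = max 0 (1 - real n * infdist x C)" for n x
    have b01: "0 \<le> b n x" "b n x \<le> 1" for n x
      by (auto simp: b_def infdist_nonneg)
    have "b n \<in> bcontfun" for n
    proof (rule bcontfun_normI[where b = 1])
      show "continuous_on UNIV (b n)"
        unfolding b_def by (intro continuous_intros)
      show "norm (b n x) \<le> 1" for x using b01[of n x] by simp
    qed
    then have Bb: "apply_bcontfun (Bcontfun (b n)) = b n" for n
      by (rule Bcontfun_inverse)
    have lim: "(\<lambda>n. b n x) \<longlonglongrightarrow> indicator C x" for x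
    proof (cases "x \<in> C")
      case True
      then show ?thesis by (simp add: b_def)
    next
      case out: False
      then have "infdist x C > 0"
        using C False by (simp add: infdist_pos_not_in_closed)
      then have "filterlim (\<lambda>n. real n * infdist x C) at_top sequentially"
        by (simp add: filterlim_at_top_mult_tendsto_pos[OF tendsto_const _ filterlim_real_sequentially])
      then have "eventually (\<lambda>n. 1 \<le> real n * infdist x C) sequentially"
        by (simp add: filterlim_at_top)
      then have "eventually (\<lambda>n. b n x = 0) sequentially"
        by eventually_elim (simp add: b_def)
      then show ?thesis
        using out by (simp add: tendsto_eventually)
    qed
    have *: "(\<lambda>n. \<integral>x. b n x \<partial>K) \<longlonglongrightarrow> measure K C" if K: "finite_borel K" for K
    proof -
      have sK: "sets K = sets borel" and fK: "finite_measure K"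
        using K by (simp_all add: finite_borel_def)
      have CK: "C \<in> sets K" using C sK by simp
      have "(\<lambda>n. \<integral>x. b n x \<partial>K) \<longlonglongrightarrow> (\<integral>x. indicator C x \<partial>K)"
      proof (rule integral_dominated_convergence[where w = "\<lambda>_. 1"])
        show "integrable K (\<lambda>_. 1 :: real)"
          using fK by (simp add: finite_measure.integrable_const)
        show "b n \<in> borel_measurable K" for n
          using finite_borel_integrable_bcontfun[OF K, of "Bcontfun (b n)"] by (simp add: Bb)
        show "AE x in K. (\<lambda>n. b n x) \<longlonglongrightarrow> indicator C x" using lim by simp
        show "AE x in K. norm (b n x) \<le> 1" for n using b01 by simp
        show "(indicator C :: 'e \<Rightarrow> real) \<in> borel_measurable K" using CK by simp
      qed
      then show ?thesis
        using CK fK by (simp add: integral_indicator[unfolded less_top] finite_measure.emeasure_finite)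
    qed
    have "(\<integral>x. b n x \<partial>N) = (\<integral>x. b n x \<partial>N')" for n
      using eq[of "Bcontfun (b n)"] by (simp add: Bb)
    then have "measure N C = measure N' C"
      using *[OF N] *[OF N'] by (simp add: LIMSEQ_unique)
    then show ?thesis
      using N N' by (simp add: finite_borel_def finite_measure.emeasure_eq_measure)
  qed simp
qed auto

text \<open>Uniqueness of real limits, test function by test function. It supplies the uniqueness
  half of (ii), (iii) and (iv).\<close>

lemma weak_convergence_unique:
  fixes N N' :: "'e::metric_space measure"
  assumes "finite_borel N" "finite_borel N'" "G \<noteq> bot"
    and "weak_convergence \<mu> N G" "weak_convergence \<mu> N' G"
  shows "N = N'"
proof (rule finite_borel_eqI_bcontfun[OF assms(1,2)])
  fix f :: "'e \<Rightarrow>\<^sub>C real"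
  show "(\<integral>x. f x \<partial>N) = (\<integral>x. f x \<partial>N')"
    using assms(3-5) by (auto simp: weak_convergence_def intro: tendsto_unique)
qed

lemma borel_prob_imp_finite_borel: "borel_prob N \<Longrightarrow> finite_borel N"
  by (simp add: borel_prob_def finite_borel_def prob_space.finite_measure)

text \<open>An approximation argument: under a common bound \<open>K\<close>, convergence on
  \<open>B\<close> passes to the span by linearity and to its closure by comparison with a nearby
  element. Linearity and the bound are asked for only eventually, since \<open>Q t\<close> is
  controlled only for \<open>t \<ge> 0\<close>.\<close>

lemma tendsto_on_closure_span:
  fixes L :: "'i \<Rightarrow> 'a::real_normed_vector \<Rightarrow> 'b::real_normed_vector"
  assumes lin: "\<forall>\<^sub>F i in G. linear (L i)"
    and bnd: "\<forall>\<^sub>F i in G. \<forall>f. norm (L i f) \<le> K * norm f"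
    and Linf: "bounded_linear Linf"
    and B: "\<And>b. b \<in> B \<Longrightarrow> ((\<lambda>i. L i b) \<longlongrightarrow> Linf b) G"
    and f: "f \<in> closure (span B)"
  shows "((\<lambda>i. L i f) \<longlongrightarrow> Linf f) G"
proof -
  interpret Linf: bounded_linear Linf by fact
  have sp: "((\<lambda>i. L i g) \<longlongrightarrow> Linf g) G" if "g \<in> span B" for g
    using that
  proof (induction rule: span_induct_alt)
    case base
    have "\<forall>\<^sub>F i in G. L i 0 = Linf 0"
      using lin by eventually_elim (simp add: linear_0 Linf.zero)
    then show ?case by (rule tendsto_eventually)
  next
    case (step a b g)
    have "((\<lambda>i. a *\<^sub>R L i b + L i g) \<longlongrightarrow> a *\<^sub>R Linf b + Linf g) G"
      using B[OF step(1)] step(2) by (intro tendsto_intros)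
    moreover have "\<forall>\<^sub>F i in G. L i (a *\<^sub>R b + g) = a *\<^sub>R L i b + L i g"
      using lin by eventually_elim (simp add: linear_add linear_scale)
    ultimately show ?case
      by (simp add: Linf.add Linf.scaleR tendsto_cong)
  qed
  obtain K0 where K0: "\<And>x. norm (Linf x) \<le> norm x * K0" "K0 \<ge> 0"
    using Linf.nonneg_bounded by blast
  \<comment> \<open>\<open>\<bar>K\<bar> + K0\<close> bounds what \<open>L i\<close> and
    \<open>Linf\<close> together do to \<open>f - g\<close>; the extra 1 makes \<open>K'\<close>
    positive, so that dividing by it is safe.\<close>
  define K' where "K' = \<bar>K\<bar> + K0 + 1"
  have K': "K' > 0" using K0 by (simp add: K'_def)
  show ?thesis
  proof (rule tendstoI)
    fix e :: real
    assume e: "e > 0"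
    then have "e / (2 * K') > 0" using K' by simp
    then obtain g where g: "g \<in> span B" "dist g f < e / (2 * K')"
      using f unfolding closure_approachable by blast
    have ng: "K' * norm (f - g) < e / 2"
      using g(2) K' by (simp add: dist_norm norm_minus_commute field_simps)
    have "\<forall>\<^sub>F i in G. dist (L i g) (Linf g) < e / 2"
      by (rule tendstoD[OF sp[OF g(1)]]) (use e in simp)
    with lin bnd show "\<forall>\<^sub>F i in G. dist (L i f) (Linf f) < e"
    proof eventually_elim
      case (elim i)
      have "L i f - Linf f = L i (f - g) - Linf (f - g) + (L i g - Linf g)"
        using elim(1) by (simp add: linear_diff Linf.diff)
      also have "norm \<dots> \<le> norm (L i (f - g)) + norm (Linf (f - g)) + norm (L i g - Linf g)"
        by (meson add_mono norm_triangle_ineq norm_triangle_ineq4 order_refl order_trans)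
      also have "norm (L i (f - g)) \<le> \<bar>K\<bar> * norm (f - g)"
        using elim(2) by (meson abs_ge_self mult_right_mono norm_ge_zero order_trans)
      also have "norm (Linf (f - g)) \<le> norm (f - g) * K0" by (rule K0)
      finally have "norm (L i f - Linf f) \<le> K' * norm (f - g) + norm (L i g - Linf g)"
        unfolding K'_def by (simp add: algebra_simps) (meson add_increasing norm_ge_zero order_trans)
      then show ?case using ng elim(3) by (simp add: dist_norm)
    qed
  qed
qed


section \<open>Transition operators\<close>

lemma sup_norm_on_upper: "finite Z \<Longrightarrow> x \<in> Z \<Longrightarrow> \<bar>f x\<bar> \<le> sup_norm_on Z f"
  unfolding sup_norm_on_def by (intro cSUP_upper) auto

lemma sup_norm_on_le: "Z \<noteq> {} \<Longrightarrow> (\<And>x. x \<in> Z \<Longrightarrow> \<bar>f x\<bar> \<le> B) \<Longrightarrow> sup_norm_on Z f \<le> B"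
  unfolding sup_norm_on_def by (intro cSUP_least)

lemma sup_norm_on_nonneg: "finite Z \<Longrightarrow> Z \<noteq> {} \<Longrightarrow> 0 \<le> sup_norm_on Z f"
  by (meson abs_ge_zero ex_in_conv order_trans sup_norm_on_upper)

lemma fun_on_scale: "f \<in> fun_on Z \<Longrightarrow> (\<lambda>x. a * f x) \<in> fun_on Z"
  by (simp add: fun_on_def)

lemma fun_on_add: "f \<in> fun_on Z \<Longrightarrow> g \<in> fun_on Z \<Longrightarrow> (\<lambda>x. f x + g x) \<in> fun_on Z"
  by (simp add: fun_on_def)

lemma fun_on_diff: "f \<in> fun_on Z \<Longrightarrow> g \<in> fun_on Z \<Longrightarrow> (\<lambda>x. f x - g x) \<in> fun_on Z"
  by (simp add: fun_on_def)

lemma fun_on_sum: "(\<And>i. i \<in> I \<Longrightarrow> f i \<in> fun_on Z) \<Longrightarrow> (\<lambda>x. \<Sum>i\<in>I. f i x) \<in> fun_on Z"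
  by (simp add: fun_on_def)

lemma fun_on_indicator: "Y \<subseteq> Z \<Longrightarrow> indicator Y \<in> fun_on Z"
  by (auto simp: fun_on_def indicator_def)

lemma fun_on_expand:
  assumes "finite Z" "f \<in> fun_on Z"
  shows "f = (\<lambda>x. \<Sum>s\<in>Z. f s * indicator {s} x)"
proof
  fix x
  have "(\<Sum>s\<in>Z. f s * indicator {s} x) = (\<Sum>s\<in>Z. if s = x then f s else 0)"
    by (intro sum.cong) (auto simp: indicator_def)
  then show "f x = (\<Sum>s\<in>Z. f s * indicator {s} x)"
    using assms by (auto simp: fun_on_def)
qed

locale trans_op =
  fixes Z' Z :: "'s set" and L
  assumes trans_op: "transition_operator Z' Z L"
begin

lemma fun_on: "f \<in> fun_on Z' \<Longrightarrow> L f \<in> fun_on Z"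
  using trans_op by (auto simp: transition_operator_def fun_on_def)

lemma nonneg: "f \<in> fun_on Z' \<Longrightarrow> (\<And>y. 0 \<le> f y) \<Longrightarrow> 0 \<le> L f x"
  using trans_op
  by (auto simp: transition_operator_def stochastic_matrix_def intro!: sum_nonneg)

text \<open>Row sums are 1. As functions vanish off their level, \<open>indicator Z\<close> is the
  constant one of C(Z).\<close>

lemma indicator: "L (indicator Z') = indicator Z"
proof -
  obtain \<mu> where \<mu>: "stochastic_matrix Z Z' \<mu>"
      "\<And>f. f \<in> fun_on Z' \<Longrightarrow> L f = (\<lambda>x. if x \<in> Z then \<Sum>y\<in>Z'. \<mu> x y * f y else 0)"
    using trans_op unfolding transition_operator_def by blast
  have "(\<Sum>y\<in>Z'. \<mu> x y * indicator Z' y) = 1" if "x \<in> Z" for x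
    using \<mu>(1) that by (simp add: stochastic_matrix_def)
  then show ?thesis
    by (auto simp: \<mu>(2)[OF fun_on_indicator] fun_eq_iff indicator_def)
qed

text \<open>Contractivity: each value of \<open>L f\<close> on \<open>Z\<close> is an average of
  values of \<open>f\<close>.\<close>

lemma bound:
  assumes "f \<in> fun_on Z'" "\<And>y. y \<in> Z' \<Longrightarrow> \<bar>f y\<bar> \<le> B" "x \<in> Z"
  shows "\<bar>L f x\<bar> \<le> B"
proof -
  obtain \<mu> where \<mu>: "stochastic_matrix Z Z' \<mu>"
      "\<And>f. f \<in> fun_on Z' \<Longrightarrow> L f = (\<lambda>x. if x \<in> Z then \<Sum>y\<in>Z'. \<mu> x y * f y else 0)"
    using trans_op unfolding transition_operator_def by blast
  have "\<bar>\<Sum>y\<in>Z'. \<mu> x y * f y\<bar> \<le> (\<Sum>y\<in>Z'. \<mu> x y * B)"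
    using \<mu>(1) assms
    by (intro order_trans[OF sum_abs] sum_mono)
       (auto simp: abs_mult stochastic_matrix_def intro!: mult_mono)
  also have "\<dots> = B"
    using \<mu>(1) assms(3) by (simp add: stochastic_matrix_def flip: sum_distrib_right)
  finally show ?thesis
    using assms by (simp add: \<mu>(2))
qed

lemmas linear = transition_operator_linear[OF trans_op]

lemma scale: "f \<in> fun_on Z' \<Longrightarrow> L (\<lambda>x. a * f x) = (\<lambda>x. a * L f x)"
  using linear[of f f a 0] by simp

lemma add: "f \<in> fun_on Z' \<Longrightarrow> g \<in> fun_on Z' \<Longrightarrow> L (\<lambda>x. f x + g x) = (\<lambda>x. L f x + L g x)"
  using linear[of f g 1 1] by simp

lemma diff: "f \<in> fun_on Z' \<Longrightarrow> g \<in> fun_on Z' \<Longrightarrow> L (\<lambda>x. f x - g x) = (\<lambda>x. L f x - L g x)"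
  using linear[of f g 1 "-1"] by simp

lemma sum:
  "finite I \<Longrightarrow> (\<And>i. i \<in> I \<Longrightarrow> f i \<in> fun_on Z') \<Longrightarrow>
    L (\<lambda>x. \<Sum>i\<in>I. f i x) = (\<lambda>x. \<Sum>i\<in>I. L (f i) x)"
proof (induction rule: finite_induct)
  case empty
  show ?case using scale[of "\<lambda>_. 0" 0] by (simp add: fun_on_def)
next
  case (insert i I)
  then show ?case by (simp add: add fun_on_sum)
qed

end


section \<open>Intertwined chains\<close>

text \<open>The assumptions (A0) to (A5). No limit space occurs here, so this locale is linear
  algebra on the finite levels.\<close>

locale intertwined_chains =
  fixes S :: "nat \<Rightarrow> 's set" and s0 :: 's
    and T D :: "nat \<Rightarrow> ('s \<Rightarrow> real) \<Rightarrow> 's \<Rightarrow> real"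
    and c :: "nat \<Rightarrow> real"
  assumes finite_S: "finite (S n)"
    and disjoint_S: "m \<noteq> n \<Longrightarrow> S m \<inter> S n = {}"
    and S_0: "S 0 = {s0}"
    and trans_T: "transition_operator (S n) (S n) (T n)"
    and c_pos: "0 < c n"
    and c_Suc: "c n < c (Suc n)"
    and trans_D: "transition_operator (S n) (S (Suc n)) (D (Suc n))"
    and range_D: "(\<lambda>f x. gen_op c T (Suc n) f x + c n * f x) ` fun_on (S (Suc n))
                    \<subseteq> D (Suc n) ` fun_on (S n)"
    and inj_D: "inj_on (D (Suc n)) (fun_on (S n))"
    and gen_D: "f \<in> fun_on (S n) \<Longrightarrow>
               gen_op c T (Suc n) (D (Suc n) f) = D (Suc n) (gen_op c T n f)"
begin

abbreviation "A \<equiv> gen_op c T"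
abbreviation "U \<equiv> up_op S c T D"
abbreviation "mass n f \<equiv> up_comp S c T D n f s0"
abbreviation "down \<equiv> down_comp D"

sublocale T: trans_op "S n" "S n" "T n" for n by unfold_locales (rule trans_T)
sublocale D: trans_op "S n" "S (Suc n)" "D (Suc n)" for n by unfold_locales (rule trans_D)

lemmas fun_ons = T.fun_on D.fun_on fun_on_scale fun_on_add fun_on_diff fun_on_sum

lemma c_less: "m < n \<Longrightarrow> c m < c n"
  using c_Suc by (rule lift_Suc_mono_less)

lemma level_eq: "s \<in> S n \<Longrightarrow> level S s = n"
  unfolding level_def using disjoint_S by (intro the_equality) blast+

lemma A_fun_on: "f \<in> fun_on (S n) \<Longrightarrow> A n f \<in> fun_on (S n)"
  unfolding gen_op_def by (intro fun_on_scale fun_on_diff T.fun_on)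

lemma A_linear: "f \<in> fun_on (S n) \<Longrightarrow> g \<in> fun_on (S n) \<Longrightarrow>
    A n (\<lambda>x. a * f x + b * g x) = (\<lambda>x. a * A n f x + b * A n g x)"
  unfolding gen_op_def by (simp add: T.linear algebra_simps)

lemma A_scale: "f \<in> fun_on (S n) \<Longrightarrow> A n (\<lambda>x. a * f x) = (\<lambda>x. a * A n f x)"
  using A_linear[of f n f a 0] by simp

lemma A_indicator: "A n (indicator (S n)) = (\<lambda>x. 0)"
  by (simp add: gen_op_def T.indicator)

lemma T_eq: "T n f = (\<lambda>x. f x + A n f x / c n)"
  using c_pos[of n] by (simp add: gen_op_def)

text \<open>The spectrum of the generator of level \<open>n\<close> is contained in \<open>{0, - c 0, \<dots>, - c (n - 1)}\<close>:
  on the range of the down-operator it is that of level \<open>n - 1\<close>, and by (A3) the induced operator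
  on the quotient by this range is the scalar \<open>- c (n - 1)\<close>.\<close>

lemma eigen_decomposition:
  assumes "f \<in> fun_on (S n)"
  shows "\<exists>a g. (\<forall>j<n. g j \<in> fun_on (S n) \<and> A n (g j) = (\<lambda>x. - c j * g j x)) \<and>
           f = (\<lambda>x. a * indicator (S n) x + (\<Sum>j<n. g j x))"
  using assms
proof (induction n arbitrary: f)
  case 0
  then have "f = (\<lambda>x. f s0 * indicator (S 0) x)"
    by (auto simp: fun_eq_iff S_0 fun_on_def indicator_def)
  then show ?case by (intro exI[of _ "f s0"] exI[of _ "\<lambda>_ _. 0"] conjI) (simp, simp only: lessThan_0 sum.empty add_0_right)
next
  case (Suc n)
  \<comment> \<open>By (A3), \<open>A (Suc n) + c n\<close> sends \<open>f\<close> to some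
    \<open>D (Suc n) p\<close>. The preimage \<open>p\<close> lives one level lower, where the
    induction hypothesis splits it.\<close>
  obtain p where p: "p \<in> fun_on (S n)"
      "(\<lambda>x. A (Suc n) f x + c n * f x) = D (Suc n) p"
    using range_D[of n] Suc.prems by (auto simp: image_subset_iff image_iff)
  obtain a g where g: "\<And>j. j < n \<Longrightarrow> g j \<in> fun_on (S n)"
      "\<And>j. j < n \<Longrightarrow> A n (g j) = (\<lambda>x. - c j * g j x)"
      and pg: "p = (\<lambda>x. a * indicator (S n) x + (\<Sum>j<n. g j x))"
    using Suc.IH[OF p(1)] by blast
  \<comment> \<open>The factor by which \<open>A (Suc n) + c n\<close> multiplies an eigenfunction
    for \<open>- c j\<close>. It is nonzero since the rates increase strictly, so dividing the lift
    of \<open>g j\<close> by it inverts that operator there.\<close>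
  define k where "k j = c n - c j" for j
  have k: "k j \<noteq> 0" if "j < n" for j
    using c_less[OF that] by (simp add: k_def)
  define G where "G j = (\<lambda>x. 1 / k j * D (Suc n) (g j) x)" for j
  have Dg: "D (Suc n) (g j) \<in> fun_on (S (Suc n))" if "j < n" for j
    using g(1) that by (simp add: fun_ons)
  have G: "G j \<in> fun_on (S (Suc n))" "A (Suc n) (G j) = (\<lambda>x. - c j * G j x)" if "j < n" for j
  proof -
    show "G j \<in> fun_on (S (Suc n))"
      unfolding G_def using Dg[OF that] by (rule fun_on_scale)
    have "A (Suc n) (D (Suc n) (g j)) = (\<lambda>x. - c j * D (Suc n) (g j) x)"
      using that g by (simp only: gen_D D.scale)
    then show "A (Suc n) (G j) = (\<lambda>x. - c j * G j x)"
      unfolding G_def A_scale[OF Dg[OF that]] by simp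
  qed
  define \<Sigma> where "\<Sigma> = (\<lambda>x. \<Sum>j<n. G j x)"
  define \<Lambda> where "\<Lambda> = (\<lambda>x. \<Sum>j<n. c j * G j x)"
  have \<Sigma>: "\<Sigma> \<in> fun_on (S (Suc n))"
    unfolding \<Sigma>_def using G(1) by (intro fun_on_sum) simp
  have A\<Sigma>: "A (Suc n) \<Sigma> = (\<lambda>x. - \<Lambda> x)"
  proof -
    have "T (Suc n) \<Sigma> = (\<lambda>x. \<Sum>j<n. T (Suc n) (G j) x)"
      unfolding \<Sigma>_def using G(1) by (intro T.sum) simp_all
    then have "A (Suc n) \<Sigma> = (\<lambda>x. \<Sum>j<n. A (Suc n) (G j) x)"
      by (simp add: gen_op_def \<Sigma>_def sum_subtractf flip: sum_distrib_left)
    also have "\<dots> = (\<lambda>x. \<Sum>j<n. - c j * G j x)"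
      using G(2) by (intro ext sum.cong) simp_all
    finally show ?thesis
      by (simp add: \<Lambda>_def sum_negf)
  qed
  \<comment> \<open>The right-hand side is \<open>A (Suc n) + c n\<close> applied to the constant
    \<open>a / c n\<close> plus \<Sigma>.\<close>
  have Dp: "D (Suc n) p x = a * indicator (S (Suc n)) x + (c n * \<Sigma> x - \<Lambda> x)" for x
  proof -
    have "D (Suc n) p =
        D (Suc n) (\<lambda>x. a * indicator (S n) x + 1 * (\<lambda>x. \<Sum>j<n. g j x) x)"
      unfolding pg by simp
    also have "\<dots> = (\<lambda>x. a * D (Suc n) (indicator (S n)) x + 1 * D (Suc n) (\<lambda>x. \<Sum>j<n. g j x) x)"
      using g(1) by (intro D.linear fun_on_indicator fun_on_sum) simp_all
    also have "D (Suc n) (\<lambda>x. \<Sum>j<n. g j x) = (\<lambda>x. \<Sum>j<n. D (Suc n) (g j) x)"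
      using g(1) by (intro D.sum) simp_all
    finally have "D (Suc n) p x = a * indicator (S (Suc n)) x + (\<Sum>j<n. D (Suc n) (g j) x)"
      by (simp add: D.indicator)
    also have "(\<Sum>j<n. D (Suc n) (g j) x) = (\<Sum>j<n. c n * G j x - c j * G j x)"
    proof (intro sum.cong refl)
      fix j assume "j \<in> {..<n}"
      then have "D (Suc n) (g j) x = k j * G j x"
        using k by (simp add: G_def)
      then show "D (Suc n) (g j) x = c n * G j x - c j * G j x"
        by (simp add: k_def left_diff_distrib)
    qed
    finally show ?thesis
      by (simp add: \<Sigma>_def \<Lambda>_def sum_subtractf sum_distrib_left)
  qed
  \<comment> \<open>A particular preimage of \<open>D (Suc n) p\<close> under
    \<open>A (Suc n) + c n\<close>. On constants that operator is multiplication by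
    \<open>c n\<close>, hence the division.\<close>
  define q where "q = (\<lambda>x. a / c n * indicator (S (Suc n)) x + 1 * \<Sigma> x)"
  have q: "q \<in> fun_on (S (Suc n))"
    unfolding q_def using \<Sigma> by (intro fun_on_add fun_on_scale fun_on_indicator) simp_all
  have Aq: "A (Suc n) q = (\<lambda>x. - \<Lambda> x)"
    unfolding q_def A_linear[OF fun_on_indicator[OF order_refl] \<Sigma>] by (simp add: A\<Sigma> A_indicator)
  \<comment> \<open>\<open>f\<close> and \<open>q\<close> have the same image under
    \<open>A (Suc n) + c n\<close>, so their difference is the new component, with eigenvalue
    \<open>- c n\<close>.\<close>
  define e where "e = (\<lambda>x. 1 * f x + (-1) * q x)"
  have e: "e \<in> fun_on (S (Suc n))"
    unfolding e_def using q Suc.prems by (intro fun_on_add fun_on_scale)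
  have Ae: "A (Suc n) e x = - c n * e x" for x
  proof -
    have "A (Suc n) e x = A (Suc n) f x - A (Suc n) q x"
      unfolding e_def A_linear[OF Suc.prems q] by simp
    also have "A (Suc n) f x = D (Suc n) p x - c n * f x"
      using fun_cong[OF p(2), of x] by simp
    also have "D (Suc n) p x - c n * f x - A (Suc n) q x = - c n * e x"
      using c_pos[of n] unfolding Aq Dp unfolding e_def q_def by (simp add: field_simps)
    finally show ?thesis .
  qed
  show ?case
  proof (intro exI[of _ "a / c n"] exI[of _ "G(n := e)"] conjI allI impI)
    fix j assume "j < Suc n"
    then have j: "j = n \<or> j < n" by auto
    show "(G(n := e)) j \<in> fun_on (S (Suc n))"
      using j G(1) e by auto
    show "A (Suc n) ((G(n := e)) j) = (\<lambda>x. - c j * (G(n := e)) j x)"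
      using j G(2) Ae by (auto simp: fun_eq_iff)
  next
    show "f = (\<lambda>x. a / c n * indicator (S (Suc n)) x + (\<Sum>j<Suc n. (G(n := e)) j x))"
      by (simp add: e_def q_def \<Sigma>_def)
  qed
qed


section \<open>The stationary measures of the chains\<close>

lemmas U_solves = up_op_solves[where S = S and c = c and T = T and D = D and n = n,
    OF trans_T c_pos trans_D range_D inj_D]
  and U_unique = up_op_unique[where S = S and c = c and T = T and D = D and n = n,
    OF trans_T c_pos trans_D range_D inj_D]
  and U_linear = up_op_linear[where S = S and c = c and T = T and D = D and n = n,
    OF trans_T c_pos trans_D range_D inj_D]
  for n

lemma U_fun_on: "f \<in> fun_on (S (Suc n)) \<Longrightarrow> U n f \<in> fun_on (S n)"
  by (rule U_solves)

text \<open>The constant one solves the defining equation of \<open>U n\<close>: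
  \<open>D (Suc n)\<close> preserves it and the generator annihilates it.\<close>

lemma U_indicator: "U n (indicator (S (Suc n))) = indicator (S n)"
  by (rule U_unique)
     (simp_all add: fun_on_indicator D.indicator A_indicator)

text \<open>On the range of \<open>D (Suc n)\<close>, (A5) moves the generator to level
  \<open>n\<close>, where \<open>A n + c n\<close> equals \<open>c n\<close> times
  \<open>T n\<close>.\<close>

lemma U_D:
  assumes "f \<in> fun_on (S n)"
  shows "U n (D (Suc n) f) = T n f"
proof (rule U_unique)
  have "D (Suc n) (T n f) = D (Suc n) (\<lambda>x. 1 * f x + 1 / c n * A n f x)"
    by (subst T_eq) simp
  also have "\<dots> = (\<lambda>x. 1 * D (Suc n) f x + 1 / c n * D (Suc n) (A n f) x)"
    by (rule D.linear[OF assms A_fun_on[OF assms]])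
  finally show "c n * D (Suc n) (T n f) x = A (Suc n) (D (Suc n) f) x + c n * D (Suc n) f x" for x
    using c_pos[of n] by (simp add: gen_D[OF assms] algebra_simps)
qed (simp_all add: T.fun_on D.fun_on assms)

text \<open>By (A5), \<open>D (Suc n)\<close> applied to \<open>A n (U n f)\<close> is the generator
  applied to \<open>D (Suc n) (U n f)\<close>. Since the generator commutes with
  \<open>A (Suc n) + c n\<close>, this is the defining equation of \<open>U n\<close> at
  \<open>A (Suc n) f\<close>.\<close>

lemma U_A:
  assumes f: "f \<in> fun_on (S (Suc n))"
  shows "U n (A (Suc n) f) = A n (U n f)"
proof (rule U_unique)
  note Uf = U_fun_on[OF f]
  have Df: "D (Suc n) (U n f) = (\<lambda>x. 1 / c n * A (Suc n) f x + 1 * f x)"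
  proof
    fix x
    have "D (Suc n) (U n f) x = (c n * D (Suc n) (U n f) x) / c n"
      using c_pos[of n] by simp
    also have "\<dots> = 1 / c n * A (Suc n) f x + 1 * f x"
      unfolding U_solves(2)[OF f] using c_pos[of n] by (simp add: add_divide_distrib)
    finally show "D (Suc n) (U n f) x = 1 / c n * A (Suc n) f x + 1 * f x" .
  qed
  show "c n * D (Suc n) (A n (U n f)) x = A (Suc n) (A (Suc n) f) x + c n * A (Suc n) f x" for x
    using c_pos[of n] unfolding gen_D[OF Uf, symmetric] Df A_linear[OF A_fun_on[OF f] f]
    by (simp add: distrib_left)
qed (intro A_fun_on U_fun_on f)+

text \<open>At this stage \<open>mass n\<close> is treated as a linear functional only;
  nonnegativity of the point masses is obtained later, from \<open>M\<close>.\<close>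

lemma mass_linear:
  "f \<in> fun_on (S n) \<Longrightarrow> g \<in> fun_on (S n) \<Longrightarrow>
    mass n (\<lambda>x. a * f x + b * g x) = a * mass n f + b * mass n g"
  by (induction n arbitrary: f g) (simp_all add: U_linear U_fun_on)

lemma mass_scale: "f \<in> fun_on (S n) \<Longrightarrow> mass n (\<lambda>x. a * f x) = a * mass n f"
  using mass_linear[of f n f a 0] by simp

lemma mass_add: "f \<in> fun_on (S n) \<Longrightarrow> g \<in> fun_on (S n) \<Longrightarrow>
    mass n (\<lambda>x. f x + g x) = mass n f + mass n g"
  using mass_linear[of f n g 1 1] by simp

lemma mass_sum:
  "finite I \<Longrightarrow> (\<And>i. i \<in> I \<Longrightarrow> f i \<in> fun_on (S n)) \<Longrightarrow>
    mass n (\<lambda>x. \<Sum>i\<in>I. f i x) = (\<Sum>i\<in>I. mass n (f i))"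
proof (induction rule: finite_induct)
  case empty
  show ?case using mass_scale[of "\<lambda>_. 0" n 0] by (simp add: fun_on_def)
next
  case (insert i I)
  then show ?case by (simp add: mass_add fun_on_sum)
qed

lemma mass_expand:
  assumes "f \<in> fun_on (S n)"
  shows "mass n f = (\<Sum>s\<in>S n. f s * stat_mass S s0 c T D n s)"
proof -
  have "mass n f = mass n (\<lambda>x. \<Sum>s\<in>S n. f s * indicator {s} x)"
    using fun_on_expand[OF finite_S assms] by (rule arg_cong)
  also have "\<dots> = (\<Sum>s\<in>S n. mass n (\<lambda>x. f s * indicator {s} x))"
    using finite_S by (intro mass_sum) (auto intro!: fun_on_scale fun_on_indicator)
  also have "\<dots> = (\<Sum>s\<in>S n. f s * stat_mass S s0 c T D n s)"
    by (intro sum.cong refl) (simp add: mass_scale fun_on_indicator stat_mass_def)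
  finally show ?thesis .
qed

lemma mass_indicator: "mass n (indicator (S n)) = 1"
  by (induction n) (simp_all add: S_0 U_indicator)

text \<open>Stationarity of the masses. \<open>U_A\<close> pushes the generator down to level 0,
  where every function is constant.\<close>

lemma mass_A: "f \<in> fun_on (S n) \<Longrightarrow> mass n (A n f) = 0"
proof (induction n arbitrary: f)
  case 0
  then have "f = (\<lambda>x. f s0 * indicator (S 0) x)"
    by (auto simp: fun_eq_iff S_0 fun_on_def indicator_def)
  then have "A 0 f = A 0 (\<lambda>x. f s0 * indicator (S 0) x)"
    by (rule arg_cong)
  also have "\<dots> = (\<lambda>x. 0)"
    by (simp add: A_scale fun_on_indicator A_indicator)
  finally show ?case by simp
qed (simp add: U_A U_fun_on)

text \<open>Stationarity makes \<open>- c j\<close> times the mass vanish, and \<open>c j\<close> is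
  positive.\<close>

lemma mass_eigen:
  assumes "f \<in> fun_on (S n)" "A n f = (\<lambda>x. - c j * f x)"
  shows "mass n f = 0"
proof -
  have "- c j * mass n f = mass n (A n f)"
    unfolding assms(2) by (rule mass_scale[OF assms(1), symmetric])
  also have "\<dots> = 0"
    by (rule mass_A[OF assms(1)])
  finally show ?thesis
    using c_pos[of j] by simp
qed

text \<open>\<open>U n\<close> after \<open>D (Suc n)\<close> is \<open>T n\<close>, which differs
  from the identity by a multiple of the generator, and the latter has mass 0. The masses of
  different levels are therefore consistent.\<close>

lemma mass_D:
  assumes "f \<in> fun_on (S n)"
  shows "mass (Suc n) (D (Suc n) f) = mass n f"
proof -
  have "mass (Suc n) (D (Suc n) f) = mass n (\<lambda>x. 1 * f x + 1 / c n * A n f x)"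
    unfolding up_comp.simps U_D[OF assms] by (subst T_eq) simp
  also have "\<dots> = 1 * mass n f + 1 / c n * mass n (A n f)"
    by (rule mass_linear[OF assms A_fun_on[OF assms]])
  finally show ?thesis
    by (simp add: mass_A[OF assms])
qed

text \<open>Constants keep their value under \<open>mass n\<close> and eigenfunctions have mass 0,
  which identifies the constant in the decomposition.\<close>

lemma eigen_decomposition_mass:
  assumes "f \<in> fun_on (S n)"
  obtains g where "\<And>j. j < n \<Longrightarrow> g j \<in> fun_on (S n)"
    "\<And>j. j < n \<Longrightarrow> A n (g j) = (\<lambda>x. - c j * g j x)"
    "f = (\<lambda>x. mass n f * indicator (S n) x + (\<Sum>j<n. g j x))"
proof -
  obtain a g
    where g_all: "\<forall>j<n. g j \<in> fun_on (S n) \<and> A n (g j) = (\<lambda>x. - c j * g j x)"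
      and f: "f = (\<lambda>x. a * indicator (S n) x + (\<Sum>j<n. g j x))"
    using eigen_decomposition[OF assms] by (elim exE conjE) (rule that)
  then have g: "g j \<in> fun_on (S n)" "A n (g j) = (\<lambda>x. - c j * g j x)" if "j < n" for j
    using that by blast+
  have "mass n f = mass n (\<lambda>x. a * indicator (S n) x + 1 * (\<lambda>x. \<Sum>j<n. g j x) x)"
    unfolding f by simp
  also have "\<dots> = a * mass n (indicator (S n)) + 1 * mass n (\<lambda>x. \<Sum>j<n. g j x)"
    using g(1) by (intro mass_linear fun_on_indicator fun_on_sum) simp_all
  also have "mass n (\<lambda>x. \<Sum>j<n. g j x) = (\<Sum>j<n. mass n (g j))"
    using g(1) by (intro mass_sum) simp_all
  also have "\<dots> = 0"
    using g by (intro sum.neutral) (simp add: mass_eigen)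
  finally have *: "mass n f = a"
    by (simp add: mass_indicator)
  have "f = (\<lambda>x. mass n f * indicator (S n) x + (\<Sum>j<n. g j x))"
    unfolding * by (rule f)
  then show ?thesis using that g by blast
qed


section \<open>Iterated down-operators\<close>

lemma down_fun_on: "f \<in> fun_on (S n) \<Longrightarrow> down n k f \<in> fun_on (S (n + k))"
  by (induction k) (simp_all add: fun_ons)

lemma down_nonneg: "f \<in> fun_on (S n) \<Longrightarrow> (\<And>y. 0 \<le> f y) \<Longrightarrow> 0 \<le> down n k f x"
  by (induction k arbitrary: x) (simp_all add: D.nonneg down_fun_on)

lemma down_indicator: "down n k (indicator (S n)) = indicator (S (n + k))"
  by (induction k) (simp_all add: D.indicator)

text \<open>Reduces the lift of a function to the lifts of indicators, which are the densities that
  (L3) compares with \<open>d\<^sub>o s\<close>.\<close>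

lemma down_expand:
  assumes "f \<in> fun_on (S n)"
  shows "down n k f = (\<lambda>u. \<Sum>s\<in>S n. f s * down n k (indicator {s}) u)"
proof (induction k)
  case 0
  show ?case using fun_on_expand[OF finite_S assms] by (simp only: down_comp.simps)
next
  case (Suc k)
  then have "down n (Suc k) f = D (Suc (n + k)) (\<lambda>u. \<Sum>s\<in>S n. f s * down n k (indicator {s}) u)"
    by simp
  also have "\<dots> = (\<lambda>u. \<Sum>s\<in>S n. D (Suc (n + k)) (\<lambda>u. f s * down n k (indicator {s}) u) u)"
    using finite_S by (intro D.sum) (auto intro!: fun_on_scale fun_on_indicator down_fun_on)
  also have "\<dots> = (\<lambda>u. \<Sum>s\<in>S n. f s * down n (Suc k) (indicator {s}) u)"
    by (intro ext sum.cong refl) (simp add: D.scale fun_on_indicator down_fun_on)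
  finally show ?case .
qed

lemma down_eigen:
  assumes "f \<in> fun_on (S n)" "A n f = (\<lambda>x. a * f x)"
  shows "A (n + k) (down n k f) = (\<lambda>x. a * down n k f x)"
  using assms by (induction k) (simp_all add: gen_D D.scale down_fun_on)

lemma mass_down: "f \<in> fun_on (S n) \<Longrightarrow> mass (n + k) (down n k f) = mass n f"
proof (induction k)
  case (Suc k)
  then show ?case using mass_D[OF down_fun_on[OF Suc.prems], of k] by simp
qed simp

lemma density_fun_eq:
  "s \<in> S n \<Longrightarrow> u \<in> S (n + k) \<Longrightarrow> density_fun S D s u = down n k (indicator {s}) u"
  by (simp add: density_fun_def level_eq)

section \<open>Powers of the transition operators\<close>

lemma T_power_fun_on: "f \<in> fun_on (S n) \<Longrightarrow> (T n ^^ i) f \<in> fun_on (S n)"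
  by (induction i) (simp_all add: fun_ons)

lemma T_power_diff:
  "f \<in> fun_on (S n) \<Longrightarrow> g \<in> fun_on (S n) \<Longrightarrow>
    (T n ^^ i) (\<lambda>x. f x - g x) = (\<lambda>x. (T n ^^ i) f x - (T n ^^ i) g x)"
  by (induction i) (simp_all add: T.diff T_power_fun_on)

lemma T_power_bound:
  assumes "f \<in> fun_on (S n)" "\<And>y. y \<in> S n \<Longrightarrow> \<bar>f y\<bar> \<le> B" "x \<in> S n"
  shows "\<bar>(T n ^^ i) f x\<bar> \<le> B"
  using assms(3)
proof (induction i arbitrary: x)
  case (Suc i)
  show ?case
    unfolding funpow.simps o_apply using Suc
    by (intro T.bound T_power_fun_on assms(1))
qed (simp add: assms)

lemma T_power_eigen:
  assumes "f \<in> fun_on (S n)" "A n f = (\<lambda>x. - a * f x)"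
  shows "(T n ^^ i) f = (\<lambda>x. (1 - a / c n) ^ i * f x)"
proof (induction i)
  case (Suc i)
  have "T n f = (\<lambda>x. (1 - a / c n) * f x)"
    by (subst T_eq) (simp add: assms(2) algebra_simps)
  then show ?case
    by (simp only: funpow.simps o_apply Suc T.scale[OF assms(1)]) (simp add: mult_ac)
qed simp

end


section \<open>The limiting semigroup\<close>

text \<open>The power is the exponential of \<open>x * ln (1 - a / x)\<close> times
  \<open>\<lfloor>x * t\<rfloor> / x\<close>, and these two factors tend to \<open>- a\<close> and
  \<open>t\<close>.\<close>

lemma tendsto_power_floor_exp:
  fixes a t :: real
  assumes "0 \<le> t"
  shows "((\<lambda>x. (1 - a / x) ^ nat \<lfloor>x * t\<rfloor>) \<longlongrightarrow> exp (- a * t)) at_top"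
proof -
  have "((\<lambda>x. real_of_int \<lfloor>x * t\<rfloor> / x) \<longlongrightarrow> t) at_top"
  proof (rule tendsto_sandwich)
    show "\<forall>\<^sub>F x in at_top. t - 1 / x \<le> real_of_int \<lfloor>x * t\<rfloor> / x"
      using eventually_gt_at_top[of 0]
    proof eventually_elim
      case (elim x)
      have "x * t - 1 \<le> real_of_int \<lfloor>x * t\<rfloor>" by linarith
      then have "(x * t - 1) / x \<le> real_of_int \<lfloor>x * t\<rfloor> / x"
        using elim by (intro divide_right_mono) simp_all
      then show ?case using elim by (simp add: diff_divide_distrib)
    qed
    show "\<forall>\<^sub>F x in at_top. real_of_int \<lfloor>x * t\<rfloor> / x \<le> t"
      using eventually_gt_at_top[of 0]
      by eventually_elim (simp add: field_simps)
    show "((\<lambda>x. t - 1 / x) \<longlongrightarrow> t) at_top" by real_asymp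
  qed simp
  moreover have "((\<lambda>x. x * ln (1 - a / x)) \<longlongrightarrow> - a) at_top"
    by real_asymp
  ultimately have "((\<lambda>x. exp ((x * ln (1 - a / x)) * (real_of_int \<lfloor>x * t\<rfloor> / x)))
      \<longlongrightarrow> exp (- a * t)) at_top"
    by (intro tendsto_intros)
  moreover have "\<forall>\<^sub>F x in at_top. exp ((x * ln (1 - a / x)) * (real_of_int \<lfloor>x * t\<rfloor> / x))
      = (1 - a / x) ^ nat \<lfloor>x * t\<rfloor>"
    \<comment> \<open>For \<open>x\<close> above 0 and \<open>a\<close> the base
      \<open>1 - a / x\<close> is positive, so its logarithm represents the power.\<close>
    using eventually_gt_at_top[of 0] eventually_gt_at_top[of a]
  proof eventually_elim
    case (elim x)
    then have "1 - a / x > 0" by (simp add: field_simps)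
    moreover have "real_of_int \<lfloor>x * t\<rfloor> = real (nat \<lfloor>x * t\<rfloor>)"
      using elim assms by simp
    ultimately show ?case
      using elim by (simp add: exp_of_nat_mult mult.commute flip: ln_realpow)
  qed
  ultimately show ?thesis
    by (rule Lim_transform_eventually)
qed

lemma apply_bcontfun_sum:
  fixes f :: "'i \<Rightarrow> 'e::topological_space \<Rightarrow>\<^sub>C real"
  shows "apply_bcontfun (\<Sum>i\<in>I. f i) x = (\<Sum>i\<in>I. f i x)"
  by (induction I rule: infinite_finite_induct) simp_all

lemma abs_apply_bcontfun_le: "\<bar>apply_bcontfun f x\<bar> \<le> norm (f :: 'e::topological_space \<Rightarrow>\<^sub>C real)"
  using norm_bounded[of f x] by simp

locale chains_limit = intertwined_chains S s0 T D c
  for S :: "nat \<Rightarrow> 's set" and s0 T D c +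
  fixes \<iota> :: "'s \<Rightarrow> 'e::metric_space"
    and d\<^sub>o :: "'s \<Rightarrow> ('e \<Rightarrow>\<^sub>C real)"
    and Q :: "real \<Rightarrow> ('e \<Rightarrow>\<^sub>C real) \<Rightarrow> ('e \<Rightarrow>\<^sub>C real)"
    and h :: "('e \<Rightarrow>\<^sub>C real) \<Rightarrow> real"
  assumes approx_point: "\<exists>s. (\<forall>n. s n \<in> S n) \<and> (\<lambda>n. \<iota> (s n)) \<longlonglongrightarrow> x"
    and dense_span: "closure (span (d\<^sub>o ` (\<Union>n. S n))) = UNIV"
    and density_limit: "s \<in> (\<Union>n. S n) \<Longrightarrow>
          (\<lambda>n. sup_norm_on (S n) (\<lambda>u. density_fun S D s u - d\<^sub>o s (\<iota> u))) \<longlonglongrightarrow> 0"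
    and c_at_top: "filterlim c at_top sequentially"
    and feller: "feller_semigroup Q"
    and semigroup_limit: "0 \<le> t \<Longrightarrow>
          (\<lambda>n. sup_norm_on (S n) (\<lambda>u. (T n ^^ nat \<lfloor>c n * t\<rfloor>) (restrict_to \<iota> (S n) f) u
                                       - Q t f (\<iota> u))) \<longlonglongrightarrow> 0"
    and h_bounded_linear: "bounded_linear h"
    and h_d: "s \<in> (\<Union>n. S n) \<Longrightarrow> h (d\<^sub>o s) = stat_mass S s0 c T D (level S s) s"
begin

text \<open>The type of points of E is inhabited, so (L1) can be applied to some point.\<close>

lemma S_nonempty: "S n \<noteq> {}"
  using approx_point[of undefined] by blast

text \<open>By (L1) every point of E is a limit of images of points of ever higher levels, and
  \<open>f\<close> is continuous. This turns uniform estimates on the levels into identities in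
  C(E).\<close>

lemma eq_0_if_vanishing_on_S:
  fixes f :: "'e \<Rightarrow>\<^sub>C real"
  assumes "\<epsilon> \<longlonglongrightarrow> 0" "\<And>k u. u \<in> S (n + k) \<Longrightarrow> \<bar>f (\<iota> u)\<bar> \<le> \<epsilon> k"
  shows "f = 0"
proof (rule bcontfun_eqI)
  fix x
  obtain s where s: "\<And>n. s n \<in> S n" "(\<lambda>n. \<iota> (s n)) \<longlonglongrightarrow> x"
    using approx_point[of x] by blast
  have "isCont (apply_bcontfun f) x"
    using continuous_on_apply_bcontfun[of UNIV f] by (simp add: continuous_on_eq_continuous_at[OF open_UNIV] del: continuous_on_apply_bcontfun)
  moreover have "(\<lambda>k. \<iota> (s (n + k))) \<longlonglongrightarrow> x"
    using LIMSEQ_ignore_initial_segment[OF s(2), of n] by (simp add: add.commute)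
  ultimately have "(\<lambda>k. f (\<iota> (s (n + k)))) \<longlonglongrightarrow> f x"
    by (rule isCont_tendsto_compose)
  moreover have "(\<lambda>k. f (\<iota> (s (n + k)))) \<longlonglongrightarrow> 0"
    by (rule Lim_null_comparison[OF _ assms(1)]) (simp add: assms(2) s(1))
  ultimately show "f x = (0 :: 'e \<Rightarrow>\<^sub>C real) x"
    by (simp add: LIMSEQ_unique)
qed

text \<open>The counterpart on E of the iterated lifts of \<open>g\<close>: the expansion of
  \<open>g\<close> in indicators, with each indicator replaced by the limit
  \<open>d\<^sub>o s\<close> of its lifts.\<close>

definition limit_fun :: "nat \<Rightarrow> ('s \<Rightarrow> real) \<Rightarrow> ('e \<Rightarrow>\<^sub>C real)" where
  "limit_fun n g = (\<Sum>s\<in>S n. g s *\<^sub>R d\<^sub>o s)"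

lemma limit_fun_add: "limit_fun n (\<lambda>x. f x + g x) = limit_fun n f + limit_fun n g"
  by (simp add: limit_fun_def scaleR_add_left sum.distrib)

lemma limit_fun_scale: "limit_fun n (\<lambda>x. a * f x) = a *\<^sub>R limit_fun n f"
  by (simp add: limit_fun_def scaleR_sum_right)

lemma limit_fun_sum: "limit_fun n (\<lambda>x. \<Sum>i\<in>I. f i x) = (\<Sum>i\<in>I. limit_fun n (f i))"
  unfolding limit_fun_def scaleR_sum_left by (rule sum.swap)

lemma limit_fun_indicator_singleton:
  assumes "s \<in> S n"
  shows "limit_fun n (indicator {s}) = d\<^sub>o s"
proof -
  have "limit_fun n (indicator {s}) = (\<Sum>r\<in>S n. if r = s then d\<^sub>o r else 0)"
    unfolding limit_fun_def by (intro sum.cong) (auto simp: indicator_def)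
  then show ?thesis using assms finite_S by simp
qed

text \<open>The error is at most a finite sum of the errors in (L3), weighted by the values of
  \<open>g\<close>.\<close>

lemma limit_fun_approx:
  assumes "g \<in> fun_on (S n)"
  shows "(\<lambda>k. sup_norm_on (S (n + k)) (\<lambda>u. down n k g u - limit_fun n g (\<iota> u))) \<longlonglongrightarrow> 0"
proof (rule tendsto_sandwich[OF _ _ tendsto_const])
  let ?e = "\<lambda>s m. sup_norm_on (S m) (\<lambda>u. density_fun S D s u - d\<^sub>o s (\<iota> u))"
  have "(\<lambda>k. \<Sum>s\<in>S n. \<bar>g s\<bar> * ?e s (k + n)) \<longlonglongrightarrow> (\<Sum>s\<in>S n. \<bar>g s\<bar> * 0)"
    by (intro tendsto_intros LIMSEQ_ignore_initial_segment density_limit) blast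
  then show "(\<lambda>k. \<Sum>s\<in>S n. \<bar>g s\<bar> * ?e s (n + k)) \<longlonglongrightarrow> 0"
    by (simp add: add.commute)
  show "\<forall>\<^sub>F k in sequentially. 0 \<le> sup_norm_on (S (n + k)) (\<lambda>u. down n k g u - limit_fun n g (\<iota> u))"
    by (simp add: sup_norm_on_nonneg finite_S S_nonempty)
  have "sup_norm_on (S (n + k)) (\<lambda>u. down n k g u - limit_fun n g (\<iota> u))
      \<le> (\<Sum>s\<in>S n. \<bar>g s\<bar> * ?e s (n + k))" for k
  proof (rule sup_norm_on_le[OF S_nonempty])
    fix u assume u: "u \<in> S (n + k)"
    have "down n k g u - limit_fun n g (\<iota> u)
        = (\<Sum>s\<in>S n. g s * down n k (indicator {s}) u) - (\<Sum>s\<in>S n. g s * d\<^sub>o s (\<iota> u))"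
      by (simp add: fun_cong[OF down_expand[OF assms]] limit_fun_def apply_bcontfun_sum)
    also have "\<dots> = (\<Sum>s\<in>S n. g s * (density_fun S D s u - d\<^sub>o s (\<iota> u)))"
      using u by (simp add: density_fun_eq right_diff_distrib sum_subtractf)
    also have "\<bar>\<dots>\<bar> \<le> (\<Sum>s\<in>S n. \<bar>g s\<bar> * ?e s (n + k))"
      using u finite_S
      by (intro order_trans[OF sum_abs] sum_mono)
         (auto simp: abs_mult intro!: mult_left_mono
            sup_norm_on_upper[where f = "\<lambda>u. density_fun S D _ u - d\<^sub>o _ (\<iota> u)"])
    finally show "\<bar>down n k g u - limit_fun n g (\<iota> u)\<bar> \<le> (\<Sum>s\<in>S n. \<bar>g s\<bar> * ?e s (n + k))" .
  qed
  then show "\<forall>\<^sub>F k in sequentially. sup_norm_on (S (n + k)) (\<lambda>u. down n k g u - limit_fun n g (\<iota> u))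
      \<le> (\<Sum>s\<in>S n. \<bar>g s\<bar> * ?e s (n + k))"
    by simp
qed

text \<open>Every lift of the constant one is the constant one, so the approximation error already
  measures the distance to 1.\<close>

lemma limit_fun_indicator: "limit_fun n (indicator (S n)) = const_bcontfun 1"
proof -
  let ?e = "\<lambda>k. sup_norm_on (S (n + k))
      (\<lambda>u. down n k (indicator (S n)) u - limit_fun n (indicator (S n)) (\<iota> u))"
  have "const_bcontfun 1 - limit_fun n (indicator (S n)) = 0"
  proof (rule eq_0_if_vanishing_on_S)
    show "?e \<longlonglongrightarrow> 0"
      by (rule limit_fun_approx) (simp add: fun_on_indicator)
    fix k u assume u: "u \<in> S (n + k)"
    then show "\<bar>(const_bcontfun 1 - limit_fun n (indicator (S n))) (\<iota> u)\<bar> \<le> ?e k"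
      using sup_norm_on_upper[OF finite_S u,
          of "\<lambda>u. down n k (indicator (S n)) u - limit_fun n (indicator (S n)) (\<iota> u)"]
      by (simp add: down_indicator const_bcontfun.rep_eq)
  qed
  then show ?thesis by simp
qed

text \<open>The lifts of an indicator are nonnegative, and this survives the limit along points
  whose images approach \<open>x\<close>.\<close>

lemma d_nonneg:
  assumes "s \<in> S n"
  shows "0 \<le> d\<^sub>o s x"
proof -
  obtain v where v: "\<And>n. v n \<in> S n" "(\<lambda>n. \<iota> (v n)) \<longlonglongrightarrow> x"
    using approx_point[of x] by blast
  let ?e = "\<lambda>k. sup_norm_on (S (n + k))
      (\<lambda>u. down n k (indicator {s}) u - limit_fun n (indicator {s}) (\<iota> u))"
  have e: "?e \<longlonglongrightarrow> 0"
    using assms by (intro limit_fun_approx fun_on_indicator) simp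
  have le: "- ?e k \<le> d\<^sub>o s (\<iota> (v (n + k)))" for k
  proof -
    have "\<bar>down n k (indicator {s}) (v (n + k)) - d\<^sub>o s (\<iota> (v (n + k)))\<bar> \<le> ?e k"
      using sup_norm_on_upper[OF finite_S v(1)[of "n + k"],
          of "\<lambda>u. down n k (indicator {s}) u - limit_fun n (indicator {s}) (\<iota> u)"]
      by (simp add: limit_fun_indicator_singleton[OF assms])
    moreover have "0 \<le> down n k (indicator {s}) (v (n + k))"
      using assms by (intro down_nonneg fun_on_indicator) auto
    ultimately show ?thesis by linarith
  qed
  have "isCont (apply_bcontfun (d\<^sub>o s)) x"
    using continuous_on_apply_bcontfun[of UNIV "d\<^sub>o s"]
    by (simp add: continuous_on_eq_continuous_at[OF open_UNIV] del: continuous_on_apply_bcontfun)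
  moreover have "(\<lambda>k. \<iota> (v (n + k))) \<longlonglongrightarrow> x"
    using LIMSEQ_ignore_initial_segment[OF v(2), of n] by (simp add: add.commute)
  ultimately have "(\<lambda>k. d\<^sub>o s (\<iota> (v (n + k)))) \<longlonglongrightarrow> d\<^sub>o s x"
    by (rule isCont_tendsto_compose)
  moreover have "(\<lambda>k. - ?e k) \<longlonglongrightarrow> 0"
    using tendsto_minus[OF e] by simp
  ultimately show ?thesis
    using le by (intro LIMSEQ_le) auto
qed

text \<open>On the range of the iterated down-operators, the powers of \<open>T m\<close> multiply the lift of an
  eigenfunction by \<open>(1 - a / c m) ^ \<lfloor>c m * t\<rfloor>\<close>, which tends to \<open>exp (- a * t)\<close>.\<close>

lemma semigroup_eigen:
  assumes g: "g \<in> fun_on (S n)" "A n g = (\<lambda>x. - a * g x)" and t: "0 \<le> t"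
  shows "Q t (limit_fun n g) = exp (- a * t) *\<^sub>R limit_fun n g"
proof -
  define f where "f = limit_fun n g"
  define i where "i k = nat \<lfloor>c (n + k) * t\<rfloor>" for k
  define r where "r k = (1 - a / c (n + k)) ^ i k" for k
  define T' where "T' k = T (n + k) ^^ i k" for k
  define \<delta> where "\<delta> k = (\<lambda>u. down n k g u - f (\<iota> u))" for k
  define \<gamma> where "\<gamma> k = (\<lambda>u. T' k (restrict_to \<iota> (S (n + k)) f) u - Q t f (\<iota> u))" for k
  \<comment> \<open>Four errors: chain against semigroup, restriction against lift under the
    contraction \<open>T' k\<close>, lift against restriction multiplied by \<open>r k\<close>, and
    the power against the exponential.\<close>
  define \<epsilon> where "\<epsilon> k = sup_norm_on (S (n + k)) (\<gamma> k) + sup_norm_on (S (n + k)) (\<delta> k)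
      + \<bar>r k\<bar> * sup_norm_on (S (n + k)) (\<delta> k) + \<bar>r k - exp (- a * t)\<bar> * norm f" for k
  have c_lim: "filterlim (\<lambda>k. c (n + k)) at_top sequentially"
    using filterlim_compose[OF c_at_top filterlim_add_const_nat_at_top[of n]]
    by (simp add: add.commute)
  have r: "r \<longlonglongrightarrow> exp (- a * t)"
    unfolding r_def i_def
    by (rule filterlim_compose[OF tendsto_power_floor_exp[OF t] c_lim])
  have \<delta>: "(\<lambda>k. sup_norm_on (S (n + k)) (\<delta> k)) \<longlonglongrightarrow> 0"
    unfolding \<delta>_def f_def by (rule limit_fun_approx[OF g(1)])
  have \<gamma>: "(\<lambda>k. sup_norm_on (S (n + k)) (\<gamma> k)) \<longlonglongrightarrow> 0"
    using LIMSEQ_ignore_initial_segment[OF semigroup_limit[OF t, of f], of n]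
    by (simp add: \<gamma>_def T'_def i_def add.commute)
  have "(\<lambda>k. \<bar>r k - exp (- a * t)\<bar>) \<longlonglongrightarrow> 0"
    using r by (rule LIM_zero[THEN tendsto_rabs_zero])
  then have "\<epsilon> \<longlonglongrightarrow> 0 + 0 + \<bar>exp (- a * t)\<bar> * 0 + 0 * norm f"
    unfolding \<epsilon>_def by (intro tendsto_intros \<delta> \<gamma> r)
  then have \<epsilon>: "\<epsilon> \<longlonglongrightarrow> 0" by simp
  have "Q t f - exp (- a * t) *\<^sub>R f = 0"
  proof (rule eq_0_if_vanishing_on_S[OF \<epsilon>])
    fix k u assume u: "u \<in> S (n + k)"
    let ?R = "restrict_to \<iota> (S (n + k)) f"
    have R: "?R \<in> fun_on (S (n + k))"
      by (simp add: restrict_to_def fun_on_def)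
    note dg = down_fun_on[OF g(1), of k]
    have "T' k (\<lambda>u. ?R u - down n k g u) = (\<lambda>u. T' k ?R u - T' k (down n k g) u)"
      unfolding T'_def by (rule T_power_diff[OF R dg])
    moreover have "T' k (down n k g) = (\<lambda>u. r k * down n k g u)"
      unfolding T'_def r_def
      by (rule T_power_eigen[OF dg down_eigen[OF g]])
    ultimately have T': "T' k (\<lambda>u. ?R u - down n k g u) u = T' k ?R u - r k * down n k g u"
      by simp
    have "\<bar>T' k (\<lambda>u. ?R u - down n k g u) u\<bar> \<le> sup_norm_on (S (n + k)) (\<delta> k)"
      unfolding T'_def
    proof (rule T_power_bound[OF fun_on_diff[OF R dg] _ u])
      fix y assume y: "y \<in> S (n + k)"
      then show "\<bar>?R y - down n k g y\<bar> \<le> sup_norm_on (S (n + k)) (\<delta> k)"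
        using sup_norm_on_upper[OF finite_S y, of "\<delta> k"]
        by (simp add: \<delta>_def restrict_to_def abs_minus_commute)
    qed
    moreover have "\<bar>\<gamma> k u\<bar> \<le> sup_norm_on (S (n + k)) (\<gamma> k)"
      by (rule sup_norm_on_upper[OF finite_S u])
    moreover have "\<bar>r k * \<delta> k u\<bar> \<le> \<bar>r k\<bar> * sup_norm_on (S (n + k)) (\<delta> k)"
      unfolding abs_mult by (intro mult_left_mono sup_norm_on_upper[OF finite_S u]) simp
    moreover have "\<bar>(r k - exp (- a * t)) * f (\<iota> u)\<bar> \<le> \<bar>r k - exp (- a * t)\<bar> * norm f"
      unfolding abs_mult by (intro mult_left_mono abs_apply_bcontfun_le) simp
    \<comment> \<open>A telescoping sum through \<open>T' k ?R u\<close>,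
      \<open>r k * down n k g u\<close> and \<open>r k * f (\<iota> u)\<close>.\<close>
    moreover have "(Q t f - exp (- a * t) *\<^sub>R f) (\<iota> u) =
        T' k (\<lambda>u. ?R u - down n k g u) u - \<gamma> k u + r k * \<delta> k u + (r k - exp (- a * t)) * f (\<iota> u)"
      unfolding T' \<gamma>_def \<delta>_def by (simp add: algebra_simps)
    ultimately show "\<bar>(Q t f - exp (- a * t) *\<^sub>R f) (\<iota> u)\<bar> \<le> \<epsilon> k"
      unfolding \<epsilon>_def by linarith
  qed
  then show ?thesis by (simp add: f_def)
qed

lemma h_d_level: "s \<in> S n \<Longrightarrow> h (d\<^sub>o s) = stat_mass S s0 c T D n s"
  using h_d[of s] level_eq[of s n] by (metis UN_I UNIV_I)

text \<open>Both sides are linear in \<open>g\<close> and agree on indicators, where the values of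
  \<open>h\<close> are prescribed. It links the functional on C(E) to the stationary masses.\<close>

lemma h_limit_fun:
  assumes "g \<in> fun_on (S n)"
  shows "h (limit_fun n g) = mass n g"
proof -
  interpret h: bounded_linear h by (rule h_bounded_linear)
  have "h (limit_fun n g) = (\<Sum>s\<in>S n. g s * h (d\<^sub>o s))"
    by (simp add: limit_fun_def h.sum h.scaleR)
  also have "\<dots> = (\<Sum>s\<in>S n. g s * stat_mass S s0 c T D n s)"
    by (simp add: h_d_level)
  finally show ?thesis by (simp add: mass_expand[OF assms])
qed

lemma h_const: "h (const_bcontfun 1) = 1"
  using h_limit_fun[of "indicator (S 0)" 0]
  by (simp add: limit_fun_indicator mass_indicator fun_on_indicator del: up_comp.simps)

lemma
  assumes "0 \<le> t"
  shows Q_linear: "linear (Q t)" and Q_bound: "norm (Q t f) \<le> norm f"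
  using feller assms by (auto simp: feller_semigroup_def bounded_linear.linear)

text \<open>After the eigenfunction decomposition \<open>Q t\<close> fixes the constant part and
  damps the others by \<open>exp (- c j * t)\<close>; the constant is the mass, hence the value of
  \<open>h\<close>.\<close>

lemma semigroup_tendsto_limit_fun:
  assumes "f \<in> fun_on (S n)"
  shows "((\<lambda>t. Q t (limit_fun n f)) \<longlongrightarrow> h (limit_fun n f) *\<^sub>R const_bcontfun 1) at_top"
proof -
  obtain g where g: "\<And>j. j < n \<Longrightarrow> g j \<in> fun_on (S n)"
      "\<And>j. j < n \<Longrightarrow> A n (g j) = (\<lambda>x. - c j * g j x)"
      and f: "f = (\<lambda>x. mass n f * indicator (S n) x + (\<Sum>j<n. g j x))"
    by (rule eigen_decomposition_mass[OF assms]) (rule that)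
  have lf: "limit_fun n f = mass n f *\<^sub>R const_bcontfun 1 + (\<Sum>j<n. limit_fun n (g j))"
    by (subst f) (simp only: limit_fun_add limit_fun_scale limit_fun_sum limit_fun_indicator)
  \<comment> \<open>Conservativity is the case \<open>a = 0\<close> of
    \<open>semigroup_eigen\<close>, for the constant one on level 0.\<close>
  have Q1: "Q t (const_bcontfun 1) = const_bcontfun 1" if "0 \<le> t" for t
    using semigroup_eigen[of "indicator (S 0)" 0 0 t] that
    by (simp add: limit_fun_indicator fun_on_indicator A_indicator)
  have "((\<lambda>t. exp (- c j * t)) \<longlongrightarrow> 0) at_top" for j
    using c_pos[of j] by real_asymp
  then have "((\<lambda>t. mass n f *\<^sub>R const_bcontfun 1 + (\<Sum>j<n. exp (- c j * t) *\<^sub>R limit_fun n (g j)))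
      \<longlongrightarrow> mass n f *\<^sub>R const_bcontfun 1 + (\<Sum>j<n. 0 *\<^sub>R limit_fun n (g j))) at_top"
    by (intro tendsto_intros)
  moreover have "\<forall>\<^sub>F t in at_top.
      mass n f *\<^sub>R const_bcontfun 1 + (\<Sum>j<n. exp (- c j * t) *\<^sub>R limit_fun n (g j)) = Q t (limit_fun n f)"
    using eventually_ge_at_top[of 0]
  proof eventually_elim
    case (elim t)
    have "Q t (limit_fun n f) =
        mass n f *\<^sub>R Q t (const_bcontfun 1) + (\<Sum>j<n. Q t (limit_fun n (g j)))"
      unfolding lf using Q_linear[OF elim] by (simp only: linear_add linear_scale linear_sum)
    also have "\<dots> = mass n f *\<^sub>R const_bcontfun 1 + (\<Sum>j<n. exp (- c j * t) *\<^sub>R limit_fun n (g j))"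
      using g elim by (intro arg_cong2[of _ _ _ _ plus] sum.cong) (simp_all add: Q1 semigroup_eigen)
    finally show ?case by simp
  qed
  ultimately have "((\<lambda>t. Q t (limit_fun n f)) \<longlongrightarrow>
      mass n f *\<^sub>R const_bcontfun 1 + (\<Sum>j<n. 0 *\<^sub>R limit_fun n (g j))) at_top"
    by (rule Lim_transform_eventually)
  then show ?thesis
    using assms by (simp add: h_limit_fun)
qed

theorem semigroup_tendsto: "((\<lambda>t. Q t f) \<longlongrightarrow> h f *\<^sub>R const_bcontfun 1) at_top"
proof (rule tendsto_on_closure_span[where K = 1 and Linf = "\<lambda>f. h f *\<^sub>R const_bcontfun 1"
      and B = "d\<^sub>o ` (\<Union>n. S n)"])
  show "\<forall>\<^sub>F t in at_top. linear (Q t)"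
    using eventually_ge_at_top[of 0] by eventually_elim (rule Q_linear)
  show "\<forall>\<^sub>F t in at_top. \<forall>f. norm (Q t f) \<le> 1 * norm f"
    using eventually_ge_at_top[of 0] by eventually_elim (simp add: Q_bound)
  show "bounded_linear (\<lambda>f. h f *\<^sub>R const_bcontfun 1 :: 'e \<Rightarrow>\<^sub>C real)"
    by (intro bounded_linear_scaleR_left[THEN bounded_linear_compose] h_bounded_linear)
  show "f \<in> closure (span (d\<^sub>o ` (\<Union>n. S n)))"
    by (simp add: dense_span)
  fix b assume "b \<in> d\<^sub>o ` (\<Union>n. S n)"
  then obtain s n where s: "s \<in> S n" "b = d\<^sub>o s" by blast
  then have "b = limit_fun n (indicator {s})"
    by (simp add: limit_fun_indicator_singleton)
  then show "((\<lambda>t. Q t b) \<longlongrightarrow> h b *\<^sub>R const_bcontfun 1) at_top"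
    using s semigroup_tendsto_limit_fun[of "indicator {s}" n] by (simp add: fun_on_indicator)
qed

text \<open>As \<open>r\<close> grows, \<open>Q (r + t) f\<close> and \<open>Q r (Q t f)\<close> are
  the same function, so their constant limits coincide.\<close>

lemma h_invariant:
  assumes "0 \<le> t"
  shows "h (Q t f) = h f"
proof -
  have lim: "((\<lambda>r. Q (r + t) f) \<longlongrightarrow> h f *\<^sub>R const_bcontfun 1) at_top"
    by (rule filterlim_compose[OF semigroup_tendsto]) real_asymp
  have "\<forall>\<^sub>F r in at_top. Q (r + t) f = Q r (Q t f)"
    using eventually_ge_at_top[of 0]
    by eventually_elim (use feller assms in \<open>simp add: feller_semigroup_def\<close>)
  with lim have "((\<lambda>r. Q r (Q t f)) \<longlongrightarrow> h f *\<^sub>R const_bcontfun 1) at_top"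
    by (rule Lim_transform_eventually)
  then have "h (Q t f) *\<^sub>R const_bcontfun 1 = h f *\<^sub>R (const_bcontfun 1 :: 'e \<Rightarrow>\<^sub>C real)"
    by (intro tendsto_unique[OF _ semigroup_tendsto]) simp
  \<comment> \<open>Applying \<open>h\<close>, which is 1 at the constant one, recovers the
    scalars.\<close>
  then have "h (h (Q t f) *\<^sub>R const_bcontfun 1) = h (h f *\<^sub>R const_bcontfun 1)"
    by (rule arg_cong)
  then show ?thesis
    by (simp add: linear_scale[OF bounded_linear.linear[OF h_bounded_linear]] h_const)
qed

end


section \<open>Characterizations of the limiting measure\<close>

text \<open>Condition on the past at time 0 and take expectations; the law of \<open>X 0\<close> is
  \<nu>.\<close>

lemma markov_process_integral:
  fixes f :: "'e::metric_space \<Rightarrow>\<^sub>C real"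
  assumes "markov_process Q \<nu> \<Omega> X" "0 \<le> t"
  shows "(\<integral>\<omega>. f (X t \<omega>) \<partial>\<Omega>) = (\<integral>x. Q t f x \<partial>\<nu>)"
proof -
  interpret prob_space \<Omega> using assms by (simp add: markov_process_def)
  have X: "X r \<in> borel_measurable \<Omega>" if "0 \<le> r" for r
    using assms that by (simp add: markov_process_def)
  have bm: "apply_bcontfun g \<in> borel_measurable borel" for g :: "'e \<Rightarrow>\<^sub>C real"
    by (intro borel_measurable_continuous_onI) simp
  have "{X r -` B \<inter> space \<Omega> | r B. 0 \<le> r \<and> r \<le> 0 \<and> B \<in> sets borel} \<subseteq> sets \<Omega>"
    using X by (auto intro: measurable_sets)
  then have "subalgebra \<Omega> (past \<Omega> X 0)"
    unfolding subalgebra_def past_def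
    by (auto simp: sets_measure_of_conv space_measure_of_conv intro: sets.sigma_sets_subset[THEN subsetD])
  then interpret finite_measure_subalgebra \<Omega> "past \<Omega> X 0"
    by unfold_locales
  have fX: "(\<lambda>\<omega>. f (X t \<omega>)) \<in> borel_measurable \<Omega>"
    by (rule measurable_compose[OF X[OF assms(2)] bm])
  have "integrable \<Omega> (\<lambda>\<omega>. f (X t \<omega>))"
    by (rule integrable_const_bound[where B = "norm f", OF _ fX]) (simp add: abs_apply_bcontfun_le)
  then have "(\<integral>\<omega>. f (X t \<omega>) \<partial>\<Omega>) = (\<integral>\<omega>. real_cond_exp \<Omega> (past \<Omega> X 0) (\<lambda>\<omega>. f (X t \<omega>)) \<omega> \<partial>\<Omega>)"
    by (rule real_cond_exp_int(2)[symmetric])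
  also have "\<dots> = (\<integral>\<omega>. Q t f (X 0 \<omega>) \<partial>\<Omega>)"
  proof (rule integral_cong_AE)
    have "\<forall>s\<ge>0. \<forall>t\<ge>0. \<forall>f. AE \<omega> in \<Omega>.
        real_cond_exp \<Omega> (past \<Omega> X s) (\<lambda>\<omega>. apply_bcontfun f (X (s + t) \<omega>)) \<omega> = Q t f (X s \<omega>)"
      using assms(1) by (simp add: markov_process_def)
    from this[rule_format, of 0 t f] assms(2)
    show "AE \<omega> in \<Omega>. real_cond_exp \<Omega> (past \<Omega> X 0) (\<lambda>\<omega>. f (X t \<omega>)) \<omega> = Q t f (X 0 \<omega>)"
      by simp
    show "(\<lambda>\<omega>. Q t f (X 0 \<omega>)) \<in> borel_measurable \<Omega>"
      by (rule measurable_compose[OF X bm]) simp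
  qed simp
  also have "\<dots> = (\<integral>x. Q t f x \<partial>distr \<Omega> borel (X 0))"
    by (rule integral_distr[symmetric, OF X bm]) simp
  finally show ?thesis
    using assms(1) by (simp add: markov_process_def)
qed

lemma law_at_integral:
  fixes f :: "'e::metric_space \<Rightarrow>\<^sub>C real"
  assumes "markov_process Q \<nu> (\<Omega> \<nu>) (F \<nu>)" "0 \<le> t"
  shows "(\<integral>x. f x \<partial>law_at \<Omega> F \<nu> t) = (\<integral>x. Q t f x \<partial>\<nu>)"
proof -
  have "apply_bcontfun f \<in> borel_measurable borel"
    by (intro borel_measurable_continuous_onI) simp
  then have "(\<integral>x. f x \<partial>law_at \<Omega> F \<nu> t) = (\<integral>\<omega>. f (F \<nu> t \<omega>) \<partial>\<Omega> \<nu>)"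
    unfolding law_at_def
    using assms by (intro integral_distr) (simp_all add: markov_process_def)
  then show ?thesis
    using markov_process_integral[OF assms] by simp
qed

lemma finite_borel_law_at:
  assumes "markov_process Q \<nu> (\<Omega> \<nu>) (F \<nu>)" "0 \<le> t"
  shows "finite_borel (law_at \<Omega> F \<nu> t)"
  using assms unfolding finite_borel_def law_at_def markov_process_def
  by (auto intro!: finite_measure.finite_measure_distr[OF prob_space.finite_measure])

lemma borel_prob_return: "borel_prob (return borel x)"
  by (simp add: borel_prob_def prob_space_return)

locale chains_limit_measure = chains_limit S s0 T D c \<iota> d\<^sub>o Q h
  for S :: "nat \<Rightarrow> 's set" and s0 T D c and \<iota> :: "'s \<Rightarrow> 'e::metric_space" and d\<^sub>o Q h +
  fixes \<Omega> :: "'e measure \<Rightarrow> 'w measure"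
    and F :: "'e measure \<Rightarrow> real \<Rightarrow> 'w \<Rightarrow> 'e"
    and M :: "'e measure"
  assumes process: "feller_process Q \<Omega> F"
    and finite_M: "finite_borel M"
    and integral_M: "(\<integral>x. apply_bcontfun f x \<partial>M) = h f"
begin

lemma markov: "borel_prob \<nu> \<Longrightarrow> markov_process Q \<nu> (\<Omega> \<nu>) (F \<nu>)"
  using process by (simp add: feller_process_def)

text \<open>The total mass is \<open>h\<close> at the constant one. This makes \<open>M\<close> an
  admissible initial distribution.\<close>

lemma borel_prob_M: "borel_prob M"
proof -
  have "measure M (space M) = 1"
    using integral_M[of "const_bcontfun 1"] by (simp add: h_const const_bcontfun.rep_eq)
  then show ?thesis
    using finite_M
    by (auto simp: borel_prob_def finite_borel_def finite_measure.emeasure_eq_measure intro!: prob_spaceI)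
qed

lemma characterizes_integrals:
  "holds_and_characterizes (\<lambda>N. \<forall>s\<in>(\<Union>n. S n).
      (\<integral>x. d\<^sub>o s x \<partial>N) = stat_mass S s0 c T D (level S s) s) M"
  unfolding holds_and_characterizes_def
proof (intro conjI allI impI)
  show "\<forall>s\<in>(\<Union>n. S n). (\<integral>x. d\<^sub>o s x \<partial>M) = stat_mass S s0 c T D (level S s) s"
    using h_d by (simp add: integral_M)
  fix N :: "'e measure"
  assume N: "finite_borel N \<and>
      (\<forall>s\<in>(\<Union>n. S n). (\<integral>x. d\<^sub>o s x \<partial>N) = stat_mass S s0 c T D (level S s) s)"
  show "N = M"
  proof (rule finite_borel_eqI_bcontfun[OF _ finite_M])
    fix f :: "'e \<Rightarrow>\<^sub>C real"
    interpret N: bounded_linear "\<lambda>f :: 'e \<Rightarrow>\<^sub>C real. \<integral>x. f x \<partial>N"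
      using N by (intro bounded_linear_integral_bcontfun) simp
    obtain K where K: "\<And>f :: 'e \<Rightarrow>\<^sub>C real. norm (\<integral>x. apply_bcontfun f x \<partial>N) \<le> norm f * K"
      using N.bounded by blast
    \<comment> \<open>For a constant sequence the density principle says that two bounded
      functionals agreeing on all \<open>d\<^sub>o s\<close> agree on C(E).\<close>
    have "((\<lambda>i::nat. \<integral>x. f x \<partial>N) \<longlongrightarrow> h f) sequentially"
      by (rule tendsto_on_closure_span[where K = K and B = "d\<^sub>o ` (\<Union>n. S n)"])
         (use K N in \<open>auto simp: h_d_level level_eq N.linear_axioms h_bounded_linear dense_span mult.commute\<close>)
    then show "(\<integral>x. f x \<partial>N) = (\<integral>x. f x \<partial>M)"
      by (simp add: integral_M LIMSEQ_const_iff)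
  qed (use N in simp)
qed

text \<open>Norm convergence of \<open>Q t f\<close> may be integrated against \<nu>, and the
  constant limit integrates to \<open>h f\<close> because \<nu> has mass 1.\<close>

lemma weak_convergence_law_at:
  assumes "borel_prob \<nu>"
  shows "weak_convergence (law_at \<Omega> F \<nu>) M at_top"
  unfolding weak_convergence_def
proof
  fix f :: "'e \<Rightarrow>\<^sub>C real"
  interpret \<nu>: bounded_linear "\<lambda>f :: 'e \<Rightarrow>\<^sub>C real. \<integral>x. f x \<partial>\<nu>"
    by (intro bounded_linear_integral_bcontfun borel_prob_imp_finite_borel assms)
  interpret prob_space \<nu> using assms by (simp add: borel_prob_def)
  have "((\<lambda>t. \<integral>x. Q t f x \<partial>\<nu>) \<longlongrightarrow> (\<integral>x. (h f *\<^sub>R const_bcontfun 1 :: 'e \<Rightarrow>\<^sub>C real) x \<partial>\<nu>)) at_top"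
    by (rule \<nu>.tendsto[OF semigroup_tendsto])
  moreover have "\<forall>\<^sub>F t in at_top. (\<integral>x. Q t f x \<partial>\<nu>) = (\<integral>x. f x \<partial>law_at \<Omega> F \<nu> t)"
    using eventually_ge_at_top[of 0]
    by eventually_elim (simp add: law_at_integral[where \<Omega> = \<Omega> and F = F, OF markov[OF assms]])
  ultimately have "((\<lambda>t. \<integral>x. f x \<partial>law_at \<Omega> F \<nu> t) \<longlongrightarrow>
      (\<integral>x. (h f *\<^sub>R const_bcontfun 1 :: 'e \<Rightarrow>\<^sub>C real) x \<partial>\<nu>)) at_top"
    by (rule Lim_transform_eventually)
  then show "((\<lambda>t. \<integral>x. f x \<partial>law_at \<Omega> F \<nu> t) \<longlongrightarrow> (\<integral>x. f x \<partial>M)) at_top"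
    by (simp add: integral_M const_bcontfun.rep_eq prob_space)
qed

lemma characterizes_long_time_limit:
  "holds_and_characterizes (\<lambda>N. \<forall>\<nu>. borel_prob \<nu> \<longrightarrow>
      weak_convergence (law_at \<Omega> F \<nu>) N at_top) M"
  unfolding holds_and_characterizes_def
proof (intro conjI allI impI)
  fix N :: "'e measure"
  assume N: "finite_borel N \<and>
      (\<forall>\<nu>. borel_prob \<nu> \<longrightarrow> weak_convergence (law_at \<Omega> F \<nu>) N at_top)"
  \<comment> \<open>For uniqueness a single initial law suffices, here the point mass at an
    arbitrary point.\<close>
  let ?\<nu> = "return borel undefined"
  have "weak_convergence (law_at \<Omega> F ?\<nu>) N at_top" "weak_convergence (law_at \<Omega> F ?\<nu>) M at_top"
    using N by (simp_all add: borel_prob_return weak_convergence_law_at)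
  then show "N = M"
    using N by (intro weak_convergence_unique[OF _ finite_M, of _ at_top]) auto
qed (rule weak_convergence_law_at)

text \<open>Invariance of \<open>h\<close> gives stationarity of \<open>M\<close>. Conversely, the
  process started from a stationary \<open>N\<close> has law \<open>N\<close> at all times, while
  this law converges to \<open>M\<close>.\<close>

lemma characterizes_stationary: "holds_and_characterizes (stationary_distribution \<Omega> F) M"
  unfolding holds_and_characterizes_def
proof (intro conjI allI impI)
  have "law_at \<Omega> F M t = M" if "0 \<le> t" for t
    using that markov[OF borel_prob_M]
    by (intro finite_borel_eqI_bcontfun finite_M)
       (simp_all add: finite_borel_law_at law_at_integral integral_M h_invariant)
  then show "stationary_distribution \<Omega> F M"
    by (simp add: stationary_distribution_def borel_prob_M)
  fix N :: "'e measure"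
  assume N: "finite_borel N \<and> stationary_distribution \<Omega> F N"
  then have pN: "borel_prob N" and law: "\<And>t. 0 \<le> t \<Longrightarrow> law_at \<Omega> F N t = N"
    by (auto simp: stationary_distribution_def)
  have "weak_convergence (law_at \<Omega> F N) N at_top"
    unfolding weak_convergence_def
    by (intro allI tendsto_eventually eventually_mono[OF eventually_ge_at_top[of 0]]) (simp add: law)
  moreover have "weak_convergence (law_at \<Omega> F N) M at_top"
    using pN by (rule weak_convergence_law_at)
  ultimately show "N = M"
    using N by (intro weak_convergence_unique[OF _ finite_M]) auto
qed

text \<open>The mass is the integral of the nonnegative \<open>d\<^sub>o s\<close> against
  \<open>M\<close>. Since \<open>ennreal\<close> truncates negative numbers to 0, this is what makes
  \<open>stat_measure\<close> carry exactly the weights \<open>stat_mass\<close>.\<close>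

lemma stat_mass_nonneg:
  assumes "s \<in> S n"
  shows "0 \<le> stat_mass S s0 c T D n s"
proof -
  have "0 \<le> (\<integral>x. d\<^sub>o s x \<partial>M)"
    by (intro Bochner_Integration.integral_nonneg d_nonneg[OF assms])
  then show ?thesis
    by (simp add: integral_M h_d_level[OF assms])
qed

lemma integral_stat_measure:
  fixes f :: "'e \<Rightarrow>\<^sub>C real"
  shows "(\<integral>x. f x \<partial>distr (stat_measure S s0 c T D n) borel \<iota>)
      = (\<Sum>u\<in>S n. stat_mass S s0 c T D n u * f (\<iota> u))"
proof -
  have "(\<integral>x. f x \<partial>distr (stat_measure S s0 c T D n) borel \<iota>)
      = (\<integral>u. f (\<iota> u) \<partial>stat_measure S s0 c T D n)"
    by (intro integral_distr borel_measurable_continuous_onI)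
       (simp_all add: stat_measure_def measurable_point_measure_eq1)
  then show ?thesis
    by (simp add: stat_measure_def lebesgue_integral_point_measure_finite finite_S stat_mass_nonneg)
qed

lemma sum_stat_mass: "(\<Sum>u\<in>S n. stat_mass S s0 c T D n u) = 1"
  using mass_expand[of "indicator (S n)" n] mass_indicator[of n] by (simp add: fun_on_indicator)

lemma sum_stat_mass_bound:
  assumes "\<And>u. u \<in> S n \<Longrightarrow> \<bar>f u\<bar> \<le> B"
  shows "\<bar>\<Sum>u\<in>S n. stat_mass S s0 c T D n u * f u\<bar> \<le> B"
proof -
  have "\<bar>\<Sum>u\<in>S n. stat_mass S s0 c T D n u * f u\<bar> \<le> (\<Sum>u\<in>S n. stat_mass S s0 c T D n u * B)"
    using assms stat_mass_nonneg
    by (intro order_trans[OF sum_abs] sum_mono) (auto simp: abs_mult intro!: mult_left_mono)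
  then show ?thesis
    by (simp add: sum_stat_mass flip: sum_distrib_right)
qed

text \<open>For \<open>d\<^sub>o s\<close> the deviation from the limit is at most the uniform error
  of the lifts. The weights form a probability vector, so the functionals are contractions and
  density gives the rest.\<close>

lemma sum_stat_mass_tendsto:
  fixes f :: "'e \<Rightarrow>\<^sub>C real"
  shows "(\<lambda>n. \<Sum>u\<in>S n. stat_mass S s0 c T D n u * f (\<iota> u)) \<longlonglongrightarrow> h f"
proof (rule tendsto_on_closure_span[where Linf = h and K = 1 and B = "d\<^sub>o ` (\<Union>n. S n)"
      and L = "\<lambda>n f. \<Sum>u\<in>S n. stat_mass S s0 c T D n u * apply_bcontfun f (\<iota> u)"])
  show "\<forall>\<^sub>F n in sequentially. linear (\<lambda>f :: 'e \<Rightarrow>\<^sub>C real. \<Sum>u\<in>S n. stat_mass S s0 c T D n u * f (\<iota> u))"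
    by (intro always_eventually allI linearI)
       (simp_all add: algebra_simps sum.distrib sum_distrib_left)
  show "\<forall>\<^sub>F n in sequentially. \<forall>f :: 'e \<Rightarrow>\<^sub>C real.
      norm (\<Sum>u\<in>S n. stat_mass S s0 c T D n u * apply_bcontfun f (\<iota> u)) \<le> 1 * norm f"
    by (simp add: sum_stat_mass_bound abs_apply_bcontfun_le)
  show "f \<in> closure (span (d\<^sub>o ` (\<Union>n. S n)))"
    by (simp add: dense_span)
  fix b assume "b \<in> d\<^sub>o ` (\<Union>n. S n)"
  then obtain s n where s: "s \<in> S n" and b: "b = d\<^sub>o s" by blast
  let ?m = "\<lambda>k f. \<Sum>u\<in>S (n + k). stat_mass S s0 c T D (n + k) u * f u"
  let ?d = "\<lambda>k. down n k (indicator {s})"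
  let ?e = "\<lambda>k. sup_norm_on (S (n + k)) (\<lambda>u. ?d k u - b (\<iota> u))"
  have ind: "indicator {s} \<in> fun_on (S n)"
    using s by (simp add: fun_on_indicator)
  have e: "?e \<longlonglongrightarrow> 0"
    using limit_fun_approx[OF ind] by (simp add: limit_fun_indicator_singleton[OF s] b)
  \<comment> \<open>Down-operators preserve mass, so the lift integrates to \<open>h b\<close>
    exactly, at every level.\<close>
  have hb: "h b = ?m k (?d k)" for k
    using h_limit_fun[OF ind] mass_down[OF ind, of k] mass_expand[OF down_fun_on[OF ind, of k]]
    by (simp add: limit_fun_indicator_singleton[OF s] b mult.commute)
  have "\<bar>?m k (\<lambda>u. b (\<iota> u)) - h b\<bar> \<le> ?e k" for k
  proof -
    have "?m k (\<lambda>u. b (\<iota> u)) - h b = - ?m k (\<lambda>u. ?d k u - b (\<iota> u))"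
      unfolding hb[of k] by (simp add: right_diff_distrib sum_subtractf)
    then show ?thesis
      using sum_stat_mass_bound[of "n + k" "\<lambda>u. ?d k u - b (\<iota> u)" "?e k"]
        sup_norm_on_upper[OF finite_S, of _ "n + k" "\<lambda>u. ?d k u - b (\<iota> u)"]
      by simp
  qed
  then have "(\<lambda>k. ?m k (\<lambda>u. b (\<iota> u)) - h b) \<longlonglongrightarrow> 0"
    by (intro Lim_null_comparison[OF _ e]) simp
  then have "(\<lambda>k. ?m k (\<lambda>u. b (\<iota> u))) \<longlonglongrightarrow> h b"
    by (rule LIM_zero_cancel)
  then show "(\<lambda>n. \<Sum>u\<in>S n. stat_mass S s0 c T D n u * b (\<iota> u)) \<longlonglongrightarrow> h b"
    by - (rule LIMSEQ_offset[where k = n], simp add: add.commute)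
qed (rule h_bounded_linear)

lemma characterizes_weak_limit:
  "holds_and_characterizes (\<lambda>N.
      weak_convergence (\<lambda>n. distr (stat_measure S s0 c T D n) borel \<iota>) N sequentially) M"
proof -
  have "weak_convergence (\<lambda>n. distr (stat_measure S s0 c T D n) borel \<iota>) M sequentially"
    using sum_stat_mass_tendsto
    by (simp add: weak_convergence_def integral_stat_measure integral_M)
  then show ?thesis
    unfolding holds_and_characterizes_def
    by (auto intro: weak_convergence_unique[OF _ finite_M, of _ sequentially])
qed

text \<open>Condition (i) with the points sorted by level.\<close>

lemma characterizes_links:
  "holds_and_characterizes (\<lambda>N. \<forall>n. \<forall>s\<in>S n.
      measure_kernel N (link_kernel d\<^sub>o) s = stat_mass S s0 c T D n s) M"
proof -
  have "(\<forall>n. \<forall>s\<in>S n. measure_kernel N (link_kernel d\<^sub>o) s = stat_mass S s0 c T D n s) \<longleftrightarrow>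
      (\<forall>s\<in>(\<Union>n. S n). (\<integral>x. d\<^sub>o s x \<partial>N) = stat_mass S s0 c T D (level S s) s)" for N
    by (auto simp: measure_kernel_def link_kernel_def level_eq)
  then show ?thesis
    using characterizes_integrals by simp
qed

end

theorem proposition4p14:
  fixes S :: "nat \<Rightarrow> 's set" and s0 :: 's
    and T D :: "nat \<Rightarrow> ('s \<Rightarrow> real) \<Rightarrow> 's \<Rightarrow> real"
    and c :: "nat \<Rightarrow> real"
    and \<iota> :: "'s \<Rightarrow> 'e::metric_space"
    and d\<^sub>o :: "'s \<Rightarrow> ('e \<Rightarrow>\<^sub>C real)"
    and Q :: "real \<Rightarrow> ('e \<Rightarrow>\<^sub>C real) \<Rightarrow> ('e \<Rightarrow>\<^sub>C real)"
    and \<Omega> :: "'e measure \<Rightarrow> 'w measure"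
    and F :: "'e measure \<Rightarrow> real \<Rightarrow> 'w \<Rightarrow> 'e"
    and h :: "('e \<Rightarrow>\<^sub>C real) \<Rightarrow> real"
    and M :: "'e measure"
  assumes A0: "\<And>n. finite (S n)" "\<And>m n. m \<noteq> n \<Longrightarrow> S m \<inter> S n = {}" "S 0 = {s0}"
    and chain: "\<And>n. transition_operator (S n) (S n) (T n)"
    and A1: "\<And>n. 0 < c n" "\<And>n. c n < c (Suc n)"
    and A2: "\<And>n. transition_operator (S n) (S (Suc n)) (D (Suc n))"
    and A3: "\<And>n. (\<lambda>f x. gen_op c T (Suc n) f x + c n * f x) ` fun_on (S (Suc n))
                    \<subseteq> D (Suc n) ` fun_on (S n)"
    and A4: "\<And>n. inj_on (D (Suc n)) (fun_on (S n))"
    and A5: "\<And>n f. f \<in> fun_on (S n) \<Longrightarrow>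
               gen_op c T (Suc n) (D (Suc n) f) = D (Suc n) (gen_op c T n f)"
    and E_compact: "compact (UNIV :: 'e set)"
    and L1: "\<And>x. \<exists>s. (\<forall>n. s n \<in> S n) \<and> (\<lambda>n. \<iota> (s n)) \<longlonglongrightarrow> x"
    and L2: "closure (span (d\<^sub>o ` (\<Union>n. S n))) = UNIV"
    and L3: "\<And>s. s \<in> (\<Union>n. S n) \<Longrightarrow>
               (\<lambda>n. sup_norm_on (S n) (\<lambda>u. density_fun S D s u - d\<^sub>o s (\<iota> u))) \<longlonglongrightarrow> 0"
    and c_unbounded: "filterlim c at_top sequentially"
    and process: "feller_process Q \<Omega> F"
    and limit: "\<And>f t. 0 \<le> t \<Longrightarrow>
               (\<lambda>n. sup_norm_on (S n) (\<lambda>u. (T n ^^ nat \<lfloor>c n * t\<rfloor>) (restrict_to \<iota> (S n) f) u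
                                            - Q t f (\<iota> u))) \<longlonglongrightarrow> 0"
    and h: "bounded_linear h"
           "\<And>s. s \<in> (\<Union>n. S n) \<Longrightarrow> h (d\<^sub>o s) = stat_mass S s0 c T D (level S s) s"
    and M: "finite_borel M" "\<And>f. (\<integral>x. apply_bcontfun f x \<partial>M) = h f"
  shows "holds_and_characterizes (\<lambda>N. \<forall>s\<in>(\<Union>n. S n).
            (\<integral>x. d\<^sub>o s x \<partial>N) = stat_mass S s0 c T D (level S s) s) M \<and>
         holds_and_characterizes (\<lambda>N. \<forall>\<nu>. borel_prob \<nu> \<longrightarrow>
            weak_convergence (law_at \<Omega> F \<nu>) N at_top) M \<and>
         holds_and_characterizes (stationary_distribution \<Omega> F) M \<and>
         holds_and_characterizes (\<lambda>N.
            weak_convergence (\<lambda>n. distr (stat_measure S s0 c T D n) borel \<iota>) N sequentially) M \<and>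
         holds_and_characterizes (\<lambda>N. \<forall>n. \<forall>s\<in>S n.
            measure_kernel N (link_kernel d\<^sub>o) s = stat_mass S s0 c T D n s) M"
proof -
  interpret h: bounded_linear h by (rule h(1))
  have feller: "feller_semigroup Q"
    using process by (simp add: feller_process_def)
  interpret chains_limit_measure S s0 T D c \<iota> d\<^sub>o Q h \<Omega> F M
    by unfold_locales (fact assms feller)+
  show ?thesis
    by (intro conjI characterizes_integrals characterizes_long_time_limit characterizes_stationary
        characterizes_weak_limit characterizes_links)
qed

end
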